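(* Let $f$ be an even measurable real function satisfying $f(\alpha+1)=f(\alpha)$, $\int_0^1 f(\alpha)\,d\alpha=0$ and $\int_0^1 f(\alpha)^2\,d\alpha<\infty$, whose Fourier series $f(\alpha)\sim\sum_{j\ge1}(a_j\cos 2\pi j\alpha+b_j\sin2\pi j\alpha)$ satisfies $|a_j|\le 1/j$ and $|b_j|\le 1/j$ for all $j\ge1$. Let $(s_\ell)_{\ell\ge1}$ be a sequence of positive integers with $s_{\ell+1}/s_\ell\ge q>1$ for all $\ell\ge1$. Then $$\limsup_{L\to\infty}\frac{\left|\sum_{\ell=1}^L f(s_\ell\alpha)\right|}{\sqrt{L\log\log L}}\le c_q$$ for almost all $\alpha\in(0,1)$, where one can take $$c_q=\max\left\{\frac{85q}{q-1},\ 122\|f\|_2^{1/4}\frac{\sqrt q}{\sqrt q-1}\right\}.$$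
   Context: $\|\cdot\|_2$ denotes the $L^2(0,1)$ norm. *)

theory Defs
  imports "HOL-Analysis.Analysis"
begin

text \<open>
  Coefficients of the Fourier series
  \<open>a\<^sub>0/2 + (\<Sum>j\<ge>1. a\<^sub>j cos (2\<pi>j\<alpha>) + b\<^sub>j sin (2\<pi>j\<alpha>))\<close> of a function of period 1;
  the factor 2 is the normalisation belonging to this form of the series.
\<close>

definition fourier_cos_coeff :: "(real \<Rightarrow> real) \<Rightarrow> nat \<Rightarrow> real" where
  "fourier_cos_coeff f j = 2 * (LINT x:{0<..<1}|lebesgue. f x * cos (2 * pi * real j * x))"

definition fourier_sin_coeff :: "(real \<Rightarrow> real) \<Rightarrow> nat \<Rightarrow> real" where
  "fourier_sin_coeff f j = 2 * (LINT x:{0<..<1}|lebesgue. f x * sin (2 * pi * real j * x))"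

definition L2_norm_01 :: "(real \<Rightarrow> real) \<Rightarrow> real" where
  "L2_norm_01 f = sqrt (LINT x:{0<..<1}|lebesgue. (f x)\<^sup>2)"

end

theory Submission
  imports Defs "HOL-Real_Asymp.Real_Asymp"
begin

text \<open>
  Expand \<open>f = (\<Sum>k. g\<^sub>k)\<close> into dyadic blocks \<open>g\<^sub>k\<close> of frequencies in \<open>[2^k, 2^(k+1))\<close>; then
  \<open>\<bar>g\<^sub>k\<bar> \<le> 1\<close> and \<open>\<integral> g\<^sub>k\<^sup>2 \<le> 2^(-k) / 2\<close>. With \<open>r \<le> q / (q - 1)\<close> such that \<open>q^r \<ge> 2\<close>, the functions
  \<open>g\<^sub>k (s\<^sub>l \<alpha>)\<close> with \<open>l\<close> in a fixed residue class modulo \<open>r (k + 2)\<close> are multiplicatively orthogonal: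
  \<open>\<integral> \<Prod> (1 + \<mu> g\<^sub>k (s\<^sub>l \<alpha>) + \<mu>\<^sup>2 g\<^sub>k (s\<^sub>l \<alpha>)\<^sup>2)\<close> is the product of the integrals, because the frequencies
  of each factor exceed the degree of the product of the previous ones. This makes the sums over the
  classes sub-Gaussian, and convexity combines the classes and the blocks with \<open>2^k\<close> up to slightly
  more than \<open>L\<close>. Dyadic chaining and a Borel--Cantelli argument yield the bound
  \<open>14 sqrt (31 r) < 85 q / (q - 1)\<close>; the remaining blocks are negligible in \<open>L\<^sup>1\<close>.
  The first entry of the maximum therefore already suffices.
\<close>

section \<open>Cosine polynomials on the unit interval\<close>

abbreviation unit_measure :: "real measure" where
  "unit_measure \<equiv> restrict_space lebesgue {0<..<1}"

abbreviation cosine :: "nat \<Rightarrow> real \<Rightarrow> real" where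
  "cosine j x \<equiv> cos (2 * pi * real j * x)"

definition cos_polys :: "nat \<Rightarrow> (real \<Rightarrow> real) set" where
  "cos_polys d = {F. \<exists>c. F = (\<lambda>x. \<Sum>j\<le>d. c j * cosine j x)}"

lemma cos_polysI: "F = (\<lambda>x. \<Sum>j\<le>d. c j * cosine j x) \<Longrightarrow> F \<in> cos_polys d"
  by (auto simp: cos_polys_def)

lemma continuous_cos_polys: "F \<in> cos_polys d \<Longrightarrow> continuous_on S F"
  by (auto simp: cos_polys_def intro!: continuous_intros)

lemma cos_polys_mono:
  assumes "F \<in> cos_polys d" "d \<le> e"
  shows "F \<in> cos_polys e"
proof -
  obtain c where c: "F = (\<lambda>x. \<Sum>j\<le>d. c j * cosine j x)"
    using assms(1) by (auto simp: cos_polys_def)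
  have "F = (\<lambda>x. \<Sum>j\<le>e. (if j \<le> d then c j else 0) * cosine j x)"
    unfolding c using assms(2)
    by (intro ext sum.mono_neutral_cong_left) auto
  then show ?thesis by (rule cos_polysI)
qed

lemma cos_polys_cosine:
  assumes "j \<le> d"
  shows "(\<lambda>x. c * cosine j x) \<in> cos_polys d"
proof -
  have "(\<lambda>x. c * cosine j x) = (\<lambda>x. \<Sum>i\<le>d. (if i = j then c else 0) * cosine i x)"
    using assms by (simp add: if_distrib[of "\<lambda>t. t * _"] cong: if_cong)
  then show ?thesis by (rule cos_polysI)
qed

lemma cos_polys_const: "(\<lambda>x. c) \<in> cos_polys d"
  using cos_polys_cosine[of 0 d c] by simp

lemma cos_polys_add:
  assumes "F \<in> cos_polys d" "G \<in> cos_polys d"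
  shows "(\<lambda>x. F x + G x) \<in> cos_polys d"
proof -
  obtain a b where ab: "F = (\<lambda>x. \<Sum>j\<le>d. a j * cosine j x)" "G = (\<lambda>x. \<Sum>j\<le>d. b j * cosine j x)"
    using assms by (auto simp: cos_polys_def)
  have "(\<lambda>x. F x + G x) = (\<lambda>x. \<Sum>j\<le>d. (a j + b j) * cosine j x)"
    unfolding ab by (simp add: sum.distrib distrib_right)
  then show ?thesis by (rule cos_polysI)
qed

lemma cos_polys_sum:
  assumes "\<And>i. i \<in> I \<Longrightarrow> F i \<in> cos_polys d"
  shows "(\<lambda>x. \<Sum>i\<in>I. F i x) \<in> cos_polys d"
  using assms
  by (induction I rule: infinite_finite_induct) (auto intro: cos_polys_const cos_polys_add)

lemma cosine_mult:
  assumes "j \<le> i"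
  shows "cosine i x * cosine j x = cosine (i + j) x / 2 + cosine (i - j) x / 2"
proof -
  have "cosine i x * cosine j x =
      (cos (2 * pi * real i * x - 2 * pi * real j * x) + cos (2 * pi * real i * x + 2 * pi * real j * x)) / 2"
    by (rule cos_times_cos)
  also have "2 * pi * real i * x - 2 * pi * real j * x = 2 * pi * real (i - j) * x"
    using assms by (simp add: of_nat_diff algebra_simps)
  also have "2 * pi * real i * x + 2 * pi * real j * x = 2 * pi * real (i + j) * x"
    by (simp add: algebra_simps)
  finally show ?thesis by simp
qed

lemma cosine_mult_cos_polys:
  assumes "i \<le> d" "j \<le> e"
  shows "(\<lambda>x. c * (cosine i x * cosine j x)) \<in> cos_polys (d + e)"
proof -
  have *: "(\<lambda>x. c * (cosine i x * cosine j x)) \<in> cos_polys (d + e)"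
    if "j \<le> i" "i + j \<le> d + e" for i j
  proof -
    have "(\<lambda>x. (c / 2) * cosine (i + j) x + (c / 2) * cosine (i - j) x) \<in> cos_polys (d + e)"
      using that by (intro cos_polys_add cos_polys_cosine) auto
    then show ?thesis
      unfolding cosine_mult[OF that(1)] by (simp add: distrib_left)
  qed
  show ?thesis
  proof (cases "j \<le> i")
    case True
    then show ?thesis using * assms by simp
  next
    case False
    then have "(\<lambda>x. c * (cosine j x * cosine i x)) \<in> cos_polys (d + e)"
      using *[of i j] assms by simp
    then show ?thesis by (simp add: mult.commute[of "cosine j _"])
  qed
qed

lemma cos_polys_mult:
  assumes "F \<in> cos_polys d" "G \<in> cos_polys e"
  shows "(\<lambda>x. F x * G x) \<in> cos_polys (d + e)"
proof -
  obtain a b where ab: "F = (\<lambda>x. \<Sum>j\<le>d. a j * cosine j x)" "G = (\<lambda>x. \<Sum>j\<le>e. b j * cosine j x)"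
    using assms by (auto simp: cos_polys_def)
  have "(\<lambda>x. F x * G x) =
      (\<lambda>x. \<Sum>i\<le>d. \<Sum>j\<le>e. (a i * b j) * (cosine i x * cosine j x))"
    unfolding ab by (simp add: sum_product mult_ac)
  also have "\<dots> \<in> cos_polys (d + e)"
    by (intro cos_polys_sum cosine_mult_cos_polys) auto
  finally show ?thesis .
qed

lemma cos_polys_dilate:
  assumes "F \<in> cos_polys d"
  shows "(\<lambda>x. F (real n * x)) \<in> cos_polys (d * n)"
proof -
  obtain a where a: "F = (\<lambda>x. \<Sum>j\<le>d. a j * cosine j x)"
    using assms by (auto simp: cos_polys_def)
  have "(\<lambda>x. F (real n * x)) = (\<lambda>x. \<Sum>j\<le>d. a j * cosine (j * n) x)"
    unfolding a by (simp add: mult_ac)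
  also have "\<dots> \<in> cos_polys (d * n)"
    by (intro cos_polys_sum cos_polys_cosine) auto
  finally show ?thesis .
qed

text \<open>From \<open>cos (2 * pi * j - t) = cos t\<close>. This symmetry about 1/2 lets an
  approximation on \<open>[0, 1/2]\<close> control the whole unit interval.\<close>

lemma cos_polys_reflect:
  assumes "F \<in> cos_polys d"
  shows "F (1 - x) = F x"
proof -
  obtain a where a: "F = (\<lambda>x. \<Sum>j\<le>d. a j * cosine j x)"
    using assms by (auto simp: cos_polys_def)
  have "cosine j (1 - x) = cosine j x" for j
  proof -
    have "cosine j (1 - x) = cos (2 * pi * real j - 2 * pi * real j * x)"
      by (simp add: algebra_simps)
    also have "\<dots> = cosine j x"
      using cos_2npi[of j] sin_2npi[of j] unfolding cos_diff
      by (simp add: mult.assoc mult.commute[of "real j" pi])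
    finally show ?thesis .
  qed
  then show ?thesis unfolding a by simp
qed

section \<open>Integration over the unit interval and orthogonality of cosines\<close>

lemma measure_unit_measure [simp]: "measure unit_measure {0<..<1} = 1"
  by (simp add: measure_restrict_space)

lemma finite_measure_unit: "finite_measure unit_measure"
  by (rule finite_measureI) (simp add: space_restrict_space emeasure_restrict_space)

lemma borel_measurable_unit:
  fixes F :: "real \<Rightarrow> real"
  assumes "continuous_on UNIV F"
  shows "F \<in> borel_measurable unit_measure"
  using borel_measurable_continuous_onI[OF assms]
  by (intro measurable_restrict_space1 measurable_completion) simp

lemma integrable_unit:
  fixes F :: "real \<Rightarrow> real"
  assumes "continuous_on UNIV F"
  shows "integrable unit_measure F"
proof -
  have "compact (F ` {0..1})"
    using assms continuous_on_subset by (intro compact_continuous_image) auto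
  then obtain B where B: "\<And>x. x \<in> {0..1} \<Longrightarrow> norm (F x) \<le> B"
    by (force simp: bounded_iff dest: compact_imp_bounded)
  show ?thesis
    by (rule finite_measure.integrable_const_bound[OF finite_measure_unit, where B=B])
      (use B in \<open>auto simp: AE_restrict_space_iff intro!: borel_measurable_unit assms\<close>)
qed

lemma integral_unit_eq:
  fixes F :: "real \<Rightarrow> real"
  shows "integral\<^sup>L unit_measure F = (LINT x:{0<..<1}|lebesgue. F x)"
  by (simp add: integral_restrict_space set_lebesgue_integral_def)

lemma integral_unit_mono:
  fixes F G :: "real \<Rightarrow> real"
  assumes "continuous_on UNIV F" "continuous_on UNIV G" "\<And>x. F x \<le> G x"
  shows "integral\<^sup>L unit_measure F \<le> integral\<^sup>L unit_measure G"
  by (intro integral_mono integrable_unit assms)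

lemma integral_cosine: "integral\<^sup>L unit_measure (cosine j) = (if j = 0 then 1 else 0)"
proof (cases "j = 0")
  case False
  define S where "S = (\<lambda>x. sin (2 * pi * real j * x) / (2 * pi * real j))"
  have cont: "continuous_on UNIV (cosine j)"
    by (intro continuous_intros)
  have S: "(cosine j has_integral S 1 - S 0) {0..1}"
    using False unfolding S_def
    by (intro fundamental_theorem_of_calculus)
      (auto intro!: derivative_eq_intros simp flip: has_real_derivative_iff_has_vector_derivative)
  moreover have "S 1 - S 0 = 0"
    using sin_2npi[of j] by (simp add: S_def mult.assoc mult.commute[of "real j" pi])
  ultimately have "(cosine j has_integral 0) {0<..<1}"
    by (simp add: has_integral_Icc_iff_Ioo)
  moreover have "set_integrable lebesgue {0<..<1} (cosine j)"
    using integrable_unit[OF cont] by (simp add: set_integrable_def integrable_restrict_space)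
  ultimately have "(LINT x:{0<..<1}|lebesgue. cosine j x) = 0"
    using set_lebesgue_integral_eq_integral(2) integral_unique by metis
  with False show ?thesis by (simp add: integral_unit_eq)
qed simp

lemma integral_cosine_mult:
  "integral\<^sup>L unit_measure (\<lambda>x. cosine i x * cosine j x) =
    (if i = j then if i = 0 then 1 else 1 / 2 else 0)"
proof -
  have *: "integral\<^sup>L unit_measure (\<lambda>x. cosine i x * cosine j x) =
    (if i = j then if i = 0 then 1 else 1 / 2 else 0)" if "j \<le> i" for i j
  proof -
    have int: "integrable unit_measure (\<lambda>x. cosine k x / 2)" for k
      by (intro integrable_unit continuous_intros) auto
    have "integral\<^sup>L unit_measure (\<lambda>x. cosine i x * cosine j x) =
        integral\<^sup>L unit_measure (cosine (i + j)) / 2 + integral\<^sup>L unit_measure (cosine (i - j)) / 2"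
      unfolding cosine_mult[OF that] by (subst Bochner_Integration.integral_add[OF int int]) simp
    then show ?thesis using that unfolding integral_cosine by auto
  qed
  show ?thesis
    using *[of i j] *[of j i] by (cases "j \<le> i") (auto simp: mult.commute)
qed

text \<open>Every nonzero frequency of \<open>P (n x)\<close> is at least \<open>n > d\<close>,
  hence differs from every frequency of \<open>F\<close>; by orthogonality only the product of the
  constant terms survives.\<close>

lemma integral_mult_dilate:
  assumes F: "F \<in> cos_polys d" and P: "P \<in> cos_polys e" and "d < n"
  shows "integral\<^sup>L unit_measure (\<lambda>x. F x * P (real n * x)) =
    integral\<^sup>L unit_measure F * integral\<^sup>L unit_measure P"
proof -
  obtain a where a: "F = (\<lambda>x. \<Sum>j\<le>d. a j * cosine j x)"
    using F by (auto simp: cos_polys_def)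
  obtain b where b: "P = (\<lambda>x. \<Sum>j\<le>e. b j * cosine j x)"
    using P by (auto simp: cos_polys_def)
  have mean: "integral\<^sup>L unit_measure (\<lambda>x. \<Sum>j\<le>d. a j * cosine j x) = a 0" for a d
  proof -
    have "integral\<^sup>L unit_measure (\<lambda>x. \<Sum>j\<le>d. a j * cosine j x) =
        (\<Sum>j\<le>d. a j * integral\<^sup>L unit_measure (cosine j))"
      by (subst Bochner_Integration.integral_sum) (auto intro!: integrable_unit continuous_intros)
    also have "\<dots> = (\<Sum>j\<le>d. if j = 0 then a j else 0)"
      by (intro sum.cong) (auto simp: integral_cosine)
    finally show ?thesis by simp
  qed
  have "integral\<^sup>L unit_measure (\<lambda>x. F x * P (real n * x)) =
      integral\<^sup>L unit_measure (\<lambda>x. \<Sum>i\<le>d. \<Sum>j\<le>e. (a i * b j) * (cosine i x * cosine (j * n) x))"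
    unfolding a b by (simp add: sum_product mult_ac)
  also have "\<dots> = (\<Sum>i\<le>d. \<Sum>j\<le>e. (a i * b j) *
      integral\<^sup>L unit_measure (\<lambda>x. cosine i x * cosine (j * n) x))"
    by (subst Bochner_Integration.integral_sum,
        (intro integrable_unit continuous_intros)[1],
        subst Bochner_Integration.integral_sum)
      (auto intro!: integrable_unit continuous_intros)
  also have "\<dots> = (\<Sum>i\<le>d. \<Sum>j\<le>e. if j = 0 then if i = 0 then a i * b j else 0 else 0)"
  proof (intro sum.cong refl)
    fix i j assume "i \<in> {..d}"
    with \<open>d < n\<close> have "i < n" by simp
    then have "i \<noteq> j * n" if "j \<noteq> 0"
      using that by (cases j) auto
    then show "a i * b j * integral\<^sup>L unit_measure (\<lambda>x. cosine i x * cosine (j * n) x) =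
        (if j = 0 then if i = 0 then a i * b j else 0 else 0)"
      using integral_cosine_mult[of i "j * n"] by auto
  qed
  also have "\<dots> = a 0 * b 0"
    by simp
  also have "\<dots> = integral\<^sup>L unit_measure F * integral\<^sup>L unit_measure P"
    unfolding a b mean ..
  finally show ?thesis .
qed

text \<open>Induction on the largest index \<open>b\<close>: the growth condition keeps the degree
  of the product over the smaller indices at most \<open>s b - 1\<close>, so the factor at
  \<open>b\<close> splits off by \<open>integral_mult_dilate\<close>. The degree bound
  \<open>e\<close> varies because the induction hypothesis is used with
  \<open>s b - 1\<close>.\<close>

lemma integral_prod_dilates:
  fixes s :: "nat \<Rightarrow> nat"
  assumes "finite A" and P: "P \<in> cos_polys d"
    and "\<And>l. l \<in> A \<Longrightarrow> s l > 0"
    and "\<And>l l'. l \<in> A \<Longrightarrow> l' \<in> A \<Longrightarrow> l < l' \<Longrightarrow> (d + 1) * s l \<le> s l'"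
    and "\<And>l. l \<in> A \<Longrightarrow> (d + 1) * s l \<le> e + 1"
  shows "(\<lambda>x. \<Prod>l\<in>A. P (real (s l) * x)) \<in> cos_polys e \<and>
    integral\<^sup>L unit_measure (\<lambda>x. \<Prod>l\<in>A. P (real (s l) * x)) = integral\<^sup>L unit_measure P ^ card A"
  using assms(1,3-5)
proof (induction A arbitrary: e rule: finite_linorder_max_induct)
  case empty
  then show ?case by (simp add: cos_polys_const)
next
  case (insert b A)
  let ?Q = "\<lambda>x. \<Prod>l\<in>A. P (real (s l) * x)"
  have sb: "s b > 0" using insert.prems by simp
  have Q: "?Q \<in> cos_polys (s b - 1)" and
    IQ: "integral\<^sup>L unit_measure ?Q = integral\<^sup>L unit_measure P ^ card A"
    using insert.IH[of "s b - 1"] insert.prems insert.hyps sb by auto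
  have b: "b \<notin> A" using insert.hyps by auto
  have eq: "(\<Prod>l\<in>insert b A. P (real (s l) * x)) = ?Q x * P (real (s b) * x)" for x
    using insert.hyps b by simp
  have "(\<lambda>x. ?Q x * P (real (s b) * x)) \<in> cos_polys (s b - 1 + d * s b)"
    by (intro cos_polys_mult Q cos_polys_dilate P)
  moreover have "s b - 1 + d * s b \<le> e"
    using insert.prems(3)[of b] sb by simp
  ultimately have "(\<lambda>x. ?Q x * P (real (s b) * x)) \<in> cos_polys e"
    by (rule cos_polys_mono)
  moreover have "integral\<^sup>L unit_measure (\<lambda>x. ?Q x * P (real (s b) * x)) =
      integral\<^sup>L unit_measure P ^ card (insert b A)"
    using integral_mult_dilate[OF Q P, of "s b"] sb IQ insert.hyps b by simp
  ultimately show ?case unfolding eq by simp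
qed

section \<open>Exponential moments of lacunary cosine sums\<close>

text \<open>Replaces the exponential by a polynomial, so that orthogonality of cosine polynomials
  becomes applicable.\<close>

lemma exp_le_quadratic:
  fixes y :: real
  assumes "\<bar>y\<bar> \<le> 1"
  shows "exp y \<le> 1 + y + y\<^sup>2"
proof (cases "y \<ge> 0")
  case True
  then show ?thesis using exp_bound assms by simp
next
  case False
  define z where "z = - y"
  have z: "0 < z" "z \<le> 1" using False assms by (auto simp: z_def)
  \<comment> \<open>For \<open>y = - z\<close> the claim is
    \<open>1 \<le> (1 - z + z^2) * exp z\<close>; already the linear minorant \<open>1 + z\<close>
    of \<open>exp z\<close> suffices.\<close>
  have "1 = (1 - z + z\<^sup>2) * (1 + z) - z ^ 3"
    by (simp add: power2_eq_square power3_eq_cube algebra_simps)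
  also have "\<dots> \<le> (1 - z + z\<^sup>2) * (1 + z)" using z by simp
  also have "\<dots> \<le> (1 - z + z\<^sup>2) * exp z"
    using z exp_ge_add_one_self[of z] by (intro mult_left_mono) (auto simp: add.commute)
  finally have "exp (- z) \<le> 1 - z + z\<^sup>2"
    by (simp add: exp_minus field_simps)
  then show ?thesis by (simp add: z_def)
qed

text \<open>Jensen's inequality for weights of total mass at most 1: the missing mass is placed at
  the point 0, where it contributes at most \<open>exp 0 = 1\<close>. The tangent of exp at the
  weighted sum does the work.\<close>

lemma exp_sum_le_weighted_sum_exp:
  fixes w y :: "'a \<Rightarrow> real"
  assumes "\<And>i. i \<in> I \<Longrightarrow> w i \<ge> 0" "sum w I \<le> 1"
  shows "exp (\<Sum>i\<in>I. w i * y i) \<le> 1 + (\<Sum>i\<in>I. w i * exp (y i))"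
proof -
  define a where "a = (\<Sum>i\<in>I. w i * y i)"
  have tangent: "exp a * (1 + (z - a)) \<le> exp z" for z
    using mult_left_mono[OF exp_ge_add_one_self[of "z - a"], of "exp a"]
    by (simp add: exp_diff)
  have "(\<Sum>i\<in>I. w i * (exp a * (1 + (y i - a)))) \<le> (\<Sum>i\<in>I. w i * exp (y i))"
    by (intro sum_mono mult_left_mono tangent assms(1))
  also have "(\<Sum>i\<in>I. w i * (exp a * (1 + (y i - a)))) = exp a * (\<Sum>i\<in>I. w i * (1 - a) + w i * y i)"
    by (simp add: sum_distrib_left algebra_simps)
  also have "(\<Sum>i\<in>I. w i * (1 - a) + w i * y i) = sum w I * (1 - a) + a"
    unfolding sum.distrib a_def sum_distrib_right ..
  finally have "exp a * (sum w I * (1 - a) + a) \<le> (\<Sum>i\<in>I. w i * exp (y i))" .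
  \<comment> \<open>The tangent inequality at \<open>z = 0\<close> accounts for the missing
    mass.\<close>
  moreover have "(1 - sum w I) * (exp a * (1 - a)) \<le> (1 - sum w I) * 1"
    using tangent[of 0] assms(2) by (intro mult_left_mono) auto
  moreover have "sum w I \<ge> 0"
    by (intro sum_nonneg assms(1))
  ultimately show ?thesis
    unfolding a_def[symmetric] by (simp add: algebra_simps)
qed

text \<open>Residues are counted from the first index \<open>m + 1\<close>; on one class the
  quotient by \<open>R\<close> is injective with values up to \<open>(N - 1) div R\<close>.\<close>

lemma card_residue_class_le:
  assumes "R > 0"
  shows "real (card {l \<in> {m<..m + N}. (l - Suc m) mod R = c}) \<le> real N / real R + 1"
proof (cases "N = 0")
  case False
  let ?C = "{l \<in> {m<..m + N}. (l - Suc m) mod R = c}"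
  have inj: "inj_on (\<lambda>l. (l - Suc m) div R) ?C"
  proof (rule inj_onI)
    fix l l' assume l: "l \<in> ?C" "l' \<in> ?C" "(l - Suc m) div R = (l' - Suc m) div R"
    then have "l - Suc m = l' - Suc m"
      by (metis (mono_tags, lifting) div_mult_mod_eq mem_Collect_eq)
    then show "l = l'" using l by auto
  qed
  have "(\<lambda>l. (l - Suc m) div R) ` ?C \<subseteq> {..(N - 1) div R}"
    by (auto intro!: div_le_mono)
  with inj have "card ?C \<le> card {..(N - 1) div R}"
    by (intro card_inj_on_le[OF inj]) auto
  then have "card ?C \<le> N div R + 1"
    using div_le_mono[of "N - 1" N R] by simp
  then have "real (card ?C) \<le> real (N div R) + 1"
    by linarith
  also have "real (N div R) \<le> real N / real R"
    by (rule of_nat_div_le_of_nat)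
  finally show ?thesis by simp
qed simp

section \<open>Dyadic frequency blocks of a cosine series\<close>

locale cosine_coeffs =
  fixes a :: "nat \<Rightarrow> real"
  assumes coeff: "j \<ge> 1 \<Longrightarrow> \<bar>a j\<bar> \<le> 1 / real j"
begin

definition g :: "nat \<Rightarrow> real \<Rightarrow> real" where
  "g k x = (\<Sum>j\<in>{2^k..<2^(k+1)}. a j * cosine j x)"

lemma continuous_g [continuous_intros]:
  fixes h :: "real \<Rightarrow> real"
  shows "continuous_on A h \<Longrightarrow> continuous_on A (\<lambda>x. g k (h x))"
  unfolding g_def by (auto intro!: continuous_intros)

lemma coeff_dyadic: "j \<in> {2^k..<2^(k+1)} \<Longrightarrow> \<bar>a j\<bar> \<le> (1 / 2) ^ k"
proof -
  assume j: "j \<in> {2^k..<2^(k+1)}"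
  then have "(2::real) ^ k \<le> real j" "j \<ge> 1"
    by (auto intro: order_trans[OF one_le_power] simp flip: of_nat_le_iff)
  then have "1 / real j \<le> 1 / 2 ^ k"
    by (intro divide_left_mono) auto
  with coeff[OF \<open>j \<ge> 1\<close>] show ?thesis by (simp add: power_one_over)
qed

lemma abs_g_le: "\<bar>g k x\<bar> \<le> 1"
proof -
  have "\<bar>g k x\<bar> \<le> (\<Sum>j\<in>{2^k..<2^(k+1)}. \<bar>a j * cosine j x\<bar>)"
    unfolding g_def by (rule sum_abs)
  also have "\<dots> \<le> (\<Sum>j\<in>{2^k..<2^(k+1)::nat}. (1 / 2) ^ k * 1)"
    unfolding abs_mult by (intro sum_mono mult_mono coeff_dyadic) auto
  also have "\<dots> = 1" by (simp add: power_one_over)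
  finally show ?thesis .
qed

lemma g_cos_polys: "g k \<in> cos_polys (2^(k+1) - 1)"
  unfolding g_def by (intro cos_polys_sum cos_polys_cosine) auto

lemma g_periodic: "g k (x + of_int i) = g k x"
proof -
  have "cosine j (x + of_int i) = cosine j x" for j
  proof -
    have "cosine j (x + of_int i) = cos (2 * pi * real j * x + 2 * pi * of_int (int j * i))"
      by (simp add: algebra_simps)
    then show ?thesis by (simp add: cos_add cos_int_2pin sin_int_2pin del: of_int_mult)
  qed
  then show ?thesis unfolding g_def by simp
qed

lemma integral_g_cosine:
  "integral\<^sup>L unit_measure (\<lambda>x. g k x * cosine j x) = (if j \<in> {2^k..<2^(k+1)} then a j / 2 else 0)"
proof -
  have "integral\<^sup>L unit_measure (\<lambda>x. g k x * cosine j x) =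
      (\<Sum>i\<in>{2^k..<2^(k+1)}. a i * integral\<^sup>L unit_measure (\<lambda>x. cosine i x * cosine j x))"
    unfolding g_def sum_distrib_right mult.assoc
    by (subst Bochner_Integration.integral_sum) (auto intro!: integrable_unit continuous_intros)
  also have "\<dots> = (\<Sum>i\<in>{2^k..<2^(k+1)}. if i = j then a j / 2 else 0)"
    by (intro sum.cong) (auto simp: integral_cosine_mult)
  finally show ?thesis by simp
qed

lemma integral_g: "integral\<^sup>L unit_measure (g k) = 0"
  using integral_g_cosine[of k 0] by simp

text \<open>Parseval: \<open>2^k\<close> terms \<open>(a j)^2 / 2\<close>, each at most
  \<open>4^(-k) / 2\<close>.\<close>

lemma integral_g_squared: "integral\<^sup>L unit_measure (\<lambda>x. (g k x)\<^sup>2) \<le> (1 / 2) ^ k / 2"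
proof -
  have "integral\<^sup>L unit_measure (\<lambda>x. (g k x)\<^sup>2) =
      integral\<^sup>L unit_measure (\<lambda>x. \<Sum>j\<in>{2^k..<2^(k+1)}. a j * (g k x * cosine j x))"
    unfolding power2_eq_square by (subst (2) g_def) (simp add: sum_distrib_left mult_ac)
  also have "\<dots> = (\<Sum>j\<in>{2^k..<2^(k+1)}. a j * integral\<^sup>L unit_measure (\<lambda>x. g k x * cosine j x))"
    by (subst Bochner_Integration.integral_sum) (auto intro!: integrable_unit continuous_intros)
  also have "\<dots> = (\<Sum>j\<in>{2^k..<2^(k+1)}. (a j)\<^sup>2 / 2)"
    by (intro sum.cong) (auto simp: integral_g_cosine power2_eq_square)
  also have "\<dots> \<le> (\<Sum>j\<in>{2^k..<2^(k+1)::nat}. ((1 / 2) ^ k)\<^sup>2 / 2)"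
    by (intro sum_mono divide_right_mono)
      (auto simp: abs_le_square_iff[symmetric] intro: coeff_dyadic)
  also have "\<dots> = (1 / 2) ^ k / 2"
    by (simp add: power_one_over power2_eq_square)
  finally show ?thesis .
qed

text \<open>Dilation by a positive integer preserves the mean of a cosine polynomial: this is
  \<open>integral_mult_dilate\<close> with the constant 1, of degree 0, as first factor.\<close>

lemma integral_g_dilate_squared:
  assumes "n \<ge> 1"
  shows "integral\<^sup>L unit_measure (\<lambda>x. (g k (real n * x))\<^sup>2) \<le> (1 / 2) ^ k / 2"
  using integral_mult_dilate[OF cos_polys_const[of 1 0] cos_polys_mult[OF g_cos_polys g_cos_polys], of n k k]
    assms integral_g_squared[of k] by (simp add: power2_eq_square)

text \<open>The L1 norm is controlled by the L2 norm through
  \<open>\<bar>y\<bar> \<le> y^2 / t + t / 2\<close>; with \<open>t = 2^(-k/2)\<close> both terms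
  contribute at most \<open>t / 2\<close> to the integral.\<close>

lemma integral_abs_g_dilate:
  assumes "n \<ge> 1"
  shows "integral\<^sup>L unit_measure (\<lambda>x. \<bar>g k (real n * x)\<bar>) \<le> sqrt (1 / 2) ^ k"
proof -
  define t :: real where "t = sqrt (1 / 2) ^ k"
  have t: "t > 0" "t\<^sup>2 = (1 / 2) ^ k"
    by (auto simp: t_def real_sqrt_power[symmetric] simp del: real_sqrt_divide)
  have "integral\<^sup>L unit_measure (\<lambda>x. \<bar>g k (real n * x)\<bar>) \<le>
      integral\<^sup>L unit_measure (\<lambda>x. (g k (real n * x))\<^sup>2 / t + t / 2)"
  proof (intro integral_unit_mono)
    fix x
    have "0 \<le> (\<bar>g k (real n * x)\<bar> - t)\<^sup>2 + (g k (real n * x))\<^sup>2"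
      by simp
    then show "\<bar>g k (real n * x)\<bar> \<le> (g k (real n * x))\<^sup>2 / t + t / 2"
      using t(1) by (simp add: power2_eq_square field_simps abs_mult_self_eq split: abs_split)
  qed (use t in \<open>auto intro!: continuous_intros\<close>)
  also have "\<dots> = integral\<^sup>L unit_measure (\<lambda>x. (g k (real n * x))\<^sup>2) / t + t / 2"
    using t by (subst Bochner_Integration.integral_add) (auto intro!: integrable_unit continuous_intros)
  also have "\<dots> \<le> t\<^sup>2 / 2 / t + t / 2"
    using integral_g_dilate_squared[OF assms, of k] t by (intro add_right_mono divide_right_mono) auto
  also have "\<dots> = t" using t(1) by (simp add: power2_eq_square)
  finally show ?thesis by (simp add: t_def)
qed

end

section \<open>Exponential moments along a sequence that doubles after every \<open>r\<close>
  steps\<close>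

locale lacunary_cosine = cosine_coeffs +
  fixes s :: "nat \<Rightarrow> nat" and r :: nat
  assumes s_pos: "l \<ge> 1 \<Longrightarrow> s l > 0"
    and r_pos: "r \<ge> 1"
    and doubling: "l \<ge> 1 \<Longrightarrow> 2 * s l \<le> s (l + r)"
begin

lemma doubling_iterate: "l \<ge> 1 \<Longrightarrow> 2 ^ n * s l \<le> s (l + n * r)"
proof (induction n)
  case (Suc n)
  have "2 ^ Suc n * s l \<le> 2 * s (l + n * r)" using Suc by simp
  also have "\<dots> \<le> s (l + n * r + r)" using Suc.prems by (intro doubling) simp
  finally show ?case by (simp add: add_ac)
qed simp

text \<open>The quadratic bound on exp turns the exponential of the sum into a product of dilates of
  one cosine polynomial \<open>P\<close>. Along the class the dilation factors grow faster than the
  degree of \<open>P\<close>, so the integral factorises, and each factor is at most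
  \<open>1 + v \<le> exp v\<close> with \<open>v = \<mu>^2 2^(-k) / 2\<close>.\<close>

lemma class_moment:
  assumes C: "C \<subseteq> {l. l \<ge> 1 \<and> l mod (r * (k + 2)) = c}" "finite C" and mu: "\<bar>\<mu>\<bar> \<le> 1"
  shows "integral\<^sup>L unit_measure (\<lambda>x. exp (\<mu> * (\<Sum>l\<in>C. g k (real (s l) * x)))) \<le>
    exp (\<mu>\<^sup>2 * ((1 / 2) ^ k / 2) * card C)"
proof -
  define P where "P = (\<lambda>x. 1 + \<mu> * g k x + \<mu>\<^sup>2 * (g k x * g k x))"
  define d where "d = (2^(k+1) - 1) + (2^(k+1) - 1 :: nat)"
  have d: "d + 1 \<le> 2 ^ (k + 2)"
  proof -
    have "(1::nat) \<le> 2 ^ (k + 1)" "(2::nat) ^ (k + 2) = 2 * 2 ^ (k + 1)" by simp_all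
    then show ?thesis unfolding d_def by linarith
  qed
  have P: "P \<in> cos_polys d"
    unfolding P_def d_def
    by (intro cos_polys_add cos_polys_const cos_polys_mult[where d=0, simplified]
        cos_polys_mult cos_polys_mono[OF g_cos_polys]) auto
  have intP: "integral\<^sup>L unit_measure P \<le> 1 + \<mu>\<^sup>2 * ((1 / 2) ^ k / 2)"
  proof -
    have "integral\<^sup>L unit_measure P = 1 + \<mu> * integral\<^sup>L unit_measure (g k) +
        \<mu>\<^sup>2 * integral\<^sup>L unit_measure (\<lambda>x. g k x * g k x)"
    proof -
      have 1: "integrable unit_measure (\<lambda>x. 1 + \<mu> * g k x)" "integrable unit_measure (\<lambda>x. \<mu> * g k x)"
        and 2: "integrable unit_measure (\<lambda>x. \<mu>\<^sup>2 * (g k x * g k x))"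
        and 3: "integrable unit_measure (\<lambda>x. 1 :: real)"
        by (auto intro!: integrable_unit continuous_intros)
      show ?thesis
        unfolding P_def Bochner_Integration.integral_add[OF 1(1) 2] Bochner_Integration.integral_add[OF 3 1(2)]
        by simp
    qed
    then show ?thesis
      using mult_left_mono[OF integral_g_squared[of k], of "\<mu>\<^sup>2"] by (simp add: integral_g power2_eq_square)
  qed
  have P_nonneg: "P x > 0" for x
  proof -
    have "P x = (1 + \<mu> * g k x / 2)\<^sup>2 + 3 / 4 * (\<mu> * g k x)\<^sup>2"
      unfolding P_def by (simp add: power2_eq_square algebra_simps)
    then show ?thesis
      by (cases "\<mu> * g k x = 0") (auto intro!: add_nonneg_pos)
  qed
  \<comment> \<open>Two indices of a class differ by a positive multiple \<open>t\<close> of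
    \<open>r (k + 2)\<close>, so \<open>s\<close> grows by a factor of at least
    \<open>2^(t (k + 2)) \<ge> d + 1\<close>.\<close>
  have sparse: "(d + 1) * s l \<le> s l'" if "l \<in> C" "l' \<in> C" "l < l'" for l l'
  proof -
    note less = that(3)
    have "l' mod (r * (k + 2)) = l mod (r * (k + 2))" using that C(1) by auto
    then obtain t where t: "l' - l = r * (k + 2) * t"
      using less_imp_le[OF less] by (metis dvdE mod_eq_dvd_iff_nat)
    then have "l' = l + r * (k + 2) * t" using less by linarith
    then have "l' = l + t * (k + 2) * r" by (simp only: mult_ac)
    moreover have "t \<noteq> 0" using t less by (intro notI) simp
    ultimately have "l' = l + t * (k + 2) * r" "t \<noteq> 0" by simp_all
    then have "2 ^ (t * (k + 2)) * s l \<le> s l'"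
      using doubling_iterate[of l "t * (k + 2)"] that(1) C(1) by auto
    moreover have "k + 2 \<le> t * (k + 2)" using \<open>t \<noteq> 0\<close> by (cases t) auto
    then have "d + 1 \<le> 2 ^ (t * (k + 2))"
      using d power_increasing[of "k + 2" "t * (k + 2)" "2::nat"] by simp
    ultimately show ?thesis
      by (meson le_trans mult_le_mono1)
  qed
  \<comment> \<open>\<open>integral_prod_dilates\<close> asks for some bound on the total degree;
    finiteness of \<open>C\<close> provides one, and its size is irrelevant.\<close>
  have "finite ((\<lambda>l. (d + 1) * s l) ` C)" using C by simp
  then obtain e where e: "\<And>l. l \<in> C \<Longrightarrow> (d + 1) * s l \<le> e"
    by (meson finite_nat_set_iff_bounded_le image_eqI)
  have prod: "integral\<^sup>L unit_measure (\<lambda>x. \<Prod>l\<in>C. P (real (s l) * x)) = integral\<^sup>L unit_measure P ^ card C"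
    using integral_prod_dilates[OF C(2) P, of s e] sparse e s_pos C(1) by (fastforce intro: le_SucI)
  have "integral\<^sup>L unit_measure (\<lambda>x. exp (\<mu> * (\<Sum>l\<in>C. g k (real (s l) * x)))) \<le>
      integral\<^sup>L unit_measure (\<lambda>x. \<Prod>l\<in>C. P (real (s l) * x))"
  proof (intro integral_unit_mono)
    fix x
    have "exp (\<mu> * (\<Sum>l\<in>C. g k (real (s l) * x))) = (\<Prod>l\<in>C. exp (\<mu> * g k (real (s l) * x)))"
      by (simp add: sum_distrib_left exp_sum[OF C(2)])
    also have "\<dots> \<le> (\<Prod>l\<in>C. P (real (s l) * x))"
    proof (intro prod_mono conjI)
      fix l
      have "\<bar>\<mu> * g k (real (s l) * x)\<bar> \<le> 1 * 1"
        unfolding abs_mult by (intro mult_mono mu abs_g_le) auto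
      then show "exp (\<mu> * g k (real (s l) * x)) \<le> P (real (s l) * x)"
        using exp_le_quadratic[of "\<mu> * g k (real (s l) * x)"]
        by (simp add: P_def power2_eq_square mult_ac)
    qed simp
    finally show "exp (\<mu> * (\<Sum>l\<in>C. g k (real (s l) * x))) \<le> (\<Prod>l\<in>C. P (real (s l) * x))" .
  qed (auto simp: P_def intro!: continuous_intros)
  also have "\<dots> \<le> exp (\<mu>\<^sup>2 * ((1 / 2) ^ k / 2)) ^ card C"
    unfolding prod
  proof (intro power_mono)
    show "integral\<^sup>L unit_measure P \<le> exp (\<mu>\<^sup>2 * ((1 / 2) ^ k / 2))"
      using intP exp_ge_add_one_self order_trans by blast
    show "0 \<le> integral\<^sup>L unit_measure P"
      using P_nonneg by (intro Bochner_Integration.integral_nonneg) (auto intro: less_imp_le)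
  qed
  also have "\<dots> = exp (\<mu>\<^sup>2 * ((1 / 2) ^ k / 2) * card C)"
    by (simp add: exp_of_nat_mult[symmetric] mult.commute)
  finally show ?thesis .
qed

text \<open>The ratio \<open>25/32 = (5/4)^2 / 2\<close> arises when the inverse squared weight
  \<open>(4/5)^(-2k)\<close> meets the variance \<open>2^(-k)\<close>. The sequence decreases from
  \<open>k = 2\<close> on, where it is about 2.44; \<open>62/25\<close> is a convenient number above
  that.\<close>

lemma weight_bound: "(real k + 2) * (25 / 32) ^ k \<le> (62 / 25 :: real)"
proof (induction k rule: less_induct)
  case (less k)
  show ?case
  proof (cases "k \<le> 2")
    case True
    then have "k = 0 \<or> k = 1 \<or> k = 2" by auto
    then show ?thesis by (auto simp: power2_eq_square)
  next
    case False
    then obtain k' where k': "k = Suc k'" "k' \<ge> 2" by (cases k) auto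
    have "(real k + 2) * (25 / 32) ^ k = ((real k' + 3) * (25 / 32)) * (25 / 32) ^ k'"
      using k' by simp
    also have "\<dots> \<le> (real k' + 2) * (25 / 32) ^ k'"
      using k' by (intro mult_right_mono) auto
    also have "\<dots> \<le> 62 / 25" using less k' by simp
    finally show ?thesis .
  qed
qed

text \<open>
  Convexity of the exponential function with the weight \<open>(1/5) (4/5)^k\<close> for the \<open>k\<close>-th dyadic
  block of frequencies, distributed evenly over the \<open>r (k + 2)\<close> residue classes.
\<close>

lemma interval_moment:
  assumes lam: "\<And>k. k < K \<Longrightarrow> \<bar>\<theta>\<bar> * (real (r * (k + 2)) * 5 * (5 / 4) ^ k) \<le> 1"
  shows "integral\<^sup>L unit_measure (\<lambda>x. exp (\<theta> * (\<Sum>l\<in>{m<..m+N}. \<Sum>k<K. g k (real (s l) * x)))) \<le>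
    3 * exp (\<theta>\<^sup>2 * (31 * real r) * real N)"
proof -
  define R where "R = (\<lambda>k. r * (k + 2))"
  \<comment> \<open>The ratio 4/5 exceeds \<open>sqrt (1/2)\<close>, so the variance
    \<open>2^(-k)\<close> divided by the squared weight still decays in \<open>k\<close>.\<close>
  define u :: "nat \<Rightarrow> real" where "u = (\<lambda>k. 1 / 5 * (4 / 5) ^ k)"
  define C where "C = (\<lambda>k c. {l \<in> {m<..m+N}. (l - Suc m) mod R k = c})"
  \<comment> \<open>Dividing \<open>\<theta>\<close> by the weight \<open>u k / R k\<close> of a
    class makes the weighted sum of the exponents \<open>y\<close> equal to \<open>\<theta>\<close>
    times the full sum.\<close>
  define \<mu> where "\<mu> = (\<lambda>k. \<theta> * real (R k) / u k)"
  define I where "I = Sigma {..<K} (\<lambda>k. {..<R k})"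
  define w where "w = (\<lambda>(k, c::nat). u k / real (R k))"
  define y where "y = (\<lambda>x (k, c). \<mu> k * (\<Sum>l\<in>C k c. g k (real (s l) * x)))"
  have R: "R k > 0" for k using r_pos by (simp add: R_def)
  have u: "u k > 0" for k by (simp add: u_def)
  have mu: "\<bar>\<mu> k\<bar> \<le> 1" if "k < K" for k
  proof -
    have "\<bar>\<mu> k\<bar> = \<bar>\<theta>\<bar> * (real (R k) * 5 * (5 / 4) ^ k)"
      by (simp add: \<mu>_def u_def abs_mult power_divide field_simps)
    then show ?thesis using lam[OF that] by (simp add: R_def)
  qed
  have sum_u: "(\<Sum>k<K. u k) \<le> 1"
    unfolding u_def sum_distrib_left[symmetric] by (subst sum_gp_strict) auto
  have w_nonneg: "w i \<ge> 0" for i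
    using less_imp_le[OF u] by (cases i) (simp add: w_def)
  have sum_w: "sum w I \<le> 1"
  proof -
    have "sum w I = (\<Sum>k<K. \<Sum>c<R k. u k / real (R k))"
      unfolding I_def by (subst sum.Sigma) (auto simp: w_def)
    also have "\<dots> = (\<Sum>k<K. u k)" using R by (intro sum.cong) auto
    finally show ?thesis using sum_u by simp
  qed
  have decomp: "\<theta> * (\<Sum>l\<in>{m<..m+N}. \<Sum>k<K. g k (real (s l) * x)) = (\<Sum>i\<in>I. w i * y x i)" for x
  proof -
    have "(\<Sum>i\<in>I. w i * y x i) =
        (\<Sum>k<K. \<Sum>c<R k. u k / real (R k) * (\<mu> k * (\<Sum>l\<in>C k c. g k (real (s l) * x))))"
      unfolding I_def by (subst sum.Sigma) (auto simp: w_def y_def intro!: sum.cong)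
    also have "\<dots> = (\<Sum>k<K. \<Sum>c<R k. \<theta> * (\<Sum>l\<in>C k c. g k (real (s l) * x)))"
      using R u by (intro sum.cong refl) (simp add: \<mu>_def less_imp_neq[symmetric])
    also have "\<dots> = (\<Sum>k<K. \<theta> * (\<Sum>l\<in>{m<..m+N}. g k (real (s l) * x)))"
      unfolding sum_distrib_left[symmetric] C_def
      using R by (intro arg_cong[where f="(*) \<theta>"] sum.cong refl sum.group) auto
    also have "\<dots> = \<theta> * (\<Sum>l\<in>{m<..m+N}. \<Sum>k<K. g k (real (s l) * x))"
      unfolding sum_distrib_left[symmetric] by (subst sum.swap) simp
    finally show ?thesis ..
  qed
  have term_bound: "integral\<^sup>L unit_measure (\<lambda>x. exp (y x i)) \<le> 2 * exp (\<theta>\<^sup>2 * (31 * real r) * real N)"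
    if "i \<in> I" for i
  proof -
    from that obtain k c where "i = (k, c)" "k \<in> {..<K}" "c \<in> {..<R k}"
      unfolding I_def by (rule SigmaE)
    then have i: "i = (k, c)" "k < K" "c < R k" by simp_all
    have Cmod: "C k c \<subseteq> {l. l \<ge> 1 \<and> l mod (r * (k + 2)) = (Suc m + c) mod R k}"
    proof
      fix l assume "l \<in> C k c"
      then have l: "m < l" "(l - Suc m) mod R k = c" by (auto simp: C_def)
      have "(Suc m + c) mod R k = (Suc m + (l - Suc m)) mod R k"
        unfolding l(2)[symmetric] by (rule mod_add_right_eq)
      then show "l \<in> {l. l \<ge> 1 \<and> l mod (r * (k + 2)) = (Suc m + c) mod R k}"
        using l(1) by (simp add: R_def)
    qed
    have "integral\<^sup>L unit_measure (\<lambda>x. exp (y x i)) \<le> exp ((\<mu> k)\<^sup>2 * ((1 / 2) ^ k / 2) * card (C k c))"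
      using class_moment[OF Cmod _ mu[OF i(2)]] by (simp add: y_def i(1) C_def)
    \<comment> \<open>The rounding term 1 in the class size adds at most
      \<open>\<mu>^2 / 2 \<le> 1 / 2\<close> to the exponent, which costs a factor
      \<open>exp (1/2) \<le> 2\<close>.\<close>
    also have "\<dots> \<le> exp (1 / 2 + \<theta>\<^sup>2 * (31 * real r) * real N)"
    proof -
      have "(\<mu> k)\<^sup>2 * ((1 / 2) ^ k / 2) * card (C k c) \<le>
          (\<mu> k)\<^sup>2 * ((1 / 2) ^ k / 2) * (real N / real (R k) + 1)"
        using card_residue_class_le[OF R] unfolding C_def by (intro mult_left_mono) auto
      also have "\<dots> = (\<mu> k)\<^sup>2 * ((1 / 2) ^ k / 2) * (real N / real (R k)) + (\<mu> k)\<^sup>2 * ((1 / 2) ^ k / 2)"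
        by (simp add: distrib_left)
      finally have 1: "(\<mu> k)\<^sup>2 * ((1 / 2) ^ k / 2) * card (C k c) \<le>
          (\<mu> k)\<^sup>2 * ((1 / 2) ^ k / 2) * (real N / real (R k)) + (\<mu> k)\<^sup>2 * ((1 / 2) ^ k / 2)" .
      have 2: "(\<mu> k)\<^sup>2 * ((1 / 2) ^ k / 2) \<le> 1 * (1 / 2)"
        using mu[OF i(2)] by (intro mult_mono) (auto simp: abs_square_le_1 power_le_one)
      have "(\<mu> k)\<^sup>2 * ((1 / 2) ^ k / 2) * (real N / real (R k)) =
          \<theta>\<^sup>2 * real N * (25 / 2 * real r) * ((real k + 2) * (25 / 32) ^ k)"
      proof -
        have "(4 / 5 :: real) ^ k * (4 / 5) ^ k * (25 / 32) ^ k = (1 / 2) ^ k"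
          by (simp flip: power_mult_distrib)
        then have "(1 / 2) ^ k / (u k)\<^sup>2 = 25 * (25 / 32 :: real) ^ k"
          by (simp add: u_def power2_eq_square field_simps)
        moreover have "(\<mu> k)\<^sup>2 * ((1 / 2) ^ k / 2) * (real N / real (R k)) =
            \<theta>\<^sup>2 * real N * (real (R k) / 2) * ((1 / 2) ^ k / (u k)\<^sup>2)"
          using R[of k] u[of k] by (simp add: \<mu>_def power2_eq_square mult_ac)
        moreover have "\<theta>\<^sup>2 * real N * (real (R k) / 2) * (25 * (25 / 32) ^ k) =
            \<theta>\<^sup>2 * real N * (25 / 2 * real r) * ((real k + 2) * (25 / 32) ^ k)"
          by (simp add: R_def algebra_simps)
        ultimately show ?thesis by (simp only:)
      qed
      \<comment> \<open>Here the constant 31 originates: \<open>25/2 * 62/25 = 31\<close>.\<close>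
      also have "\<dots> \<le> \<theta>\<^sup>2 * real N * (25 / 2 * real r) * (62 / 25)"
        by (intro mult_left_mono weight_bound) auto
      also have "\<dots> = \<theta>\<^sup>2 * (31 * real r) * real N" by simp
      finally have "(\<mu> k)\<^sup>2 * ((1 / 2) ^ k / 2) * (real N / real (R k)) \<le> \<theta>\<^sup>2 * (31 * real r) * real N" .
      with 1 2 have "(\<mu> k)\<^sup>2 * ((1 / 2) ^ k / 2) * card (C k c) \<le> 1 / 2 + \<theta>\<^sup>2 * (31 * real r) * real N"
        by linarith
      then show ?thesis by simp
    qed
    also have "\<dots> \<le> 2 * exp (\<theta>\<^sup>2 * (31 * real r) * real N)"
      unfolding exp_add using exp_half_le2 by (intro mult_right_mono) auto
    finally show ?thesis .
  qed
  have cont: "continuous_on UNIV (\<lambda>x. y x i)" for i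
    by (cases i) (auto simp: y_def intro!: continuous_intros)
  have "integral\<^sup>L unit_measure (\<lambda>x. exp (\<theta> * (\<Sum>l\<in>{m<..m+N}. \<Sum>k<K. g k (real (s l) * x)))) \<le>
      integral\<^sup>L unit_measure (\<lambda>x. 1 + (\<Sum>i\<in>I. w i * exp (y x i)))"
    unfolding decomp
    by (intro integral_unit_mono exp_sum_le_weighted_sum_exp w_nonneg sum_w continuous_intros cont)
  also have "\<dots> = 1 + (\<Sum>i\<in>I. w i * integral\<^sup>L unit_measure (\<lambda>x. exp (y x i)))"
  proof -
    have 1: "integrable unit_measure (\<lambda>x. w i * exp (y x i))" for i
      by (intro integrable_unit continuous_intros cont)
    then have 2: "integrable unit_measure (\<lambda>x. \<Sum>i\<in>I. w i * exp (y x i))"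
      by (intro Bochner_Integration.integrable_sum)
    have 3: "integrable unit_measure (\<lambda>x. 1 :: real)"
      by (auto intro!: integrable_unit continuous_intros)
    show ?thesis
      unfolding Bochner_Integration.integral_add[OF 3 2] Bochner_Integration.integral_sum[OF 1] by simp
  qed
  also have "\<dots> \<le> 1 + (\<Sum>i\<in>I. w i * (2 * exp (\<theta>\<^sup>2 * (31 * real r) * real N)))"
    by (intro add_left_mono sum_mono mult_left_mono term_bound w_nonneg)
  also have "\<dots> = 1 + sum w I * (2 * exp (\<theta>\<^sup>2 * (31 * real r) * real N))"
    by (simp add: sum_distrib_right)
  also have "\<dots> \<le> 1 + 1 * (2 * exp (\<theta>\<^sup>2 * (31 * real r) * real N))"
    using sum_w by (intro add_left_mono mult_right_mono) auto
  also have "\<dots> \<le> 3 * exp (\<theta>\<^sup>2 * (31 * real r) * real N)"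
    by simp
  finally show ?thesis .
qed

end

section \<open>Almost everywhere statements\<close>

text \<open>By monotone convergence the series has a finite integral, hence is finite almost
  everywhere. This carries the Borel--Cantelli argument and the treatment of the high
  frequencies.\<close>

lemma AE_summable_of_integrals:
  fixes F :: "nat \<Rightarrow> real \<Rightarrow> real"
  assumes cont: "\<And>n. continuous_on UNIV (F n)" and nonneg: "\<And>n x. 0 \<le> F n x"
    and bound: "\<And>n. integral\<^sup>L unit_measure (F n) \<le> c n" and "summable c"
  shows "AE x in unit_measure. summable (\<lambda>n. F n x)"
proof -
  have meas: "(\<lambda>x. ennreal (F n x)) \<in> borel_measurable unit_measure" for n
    by (intro measurable_compose[OF borel_measurable_unit[OF cont]]) simp
  have c: "0 \<le> c n" for n
    using bound[of n] nonneg by (meson Bochner_Integration.integral_nonneg order_trans)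
  have "(\<integral>\<^sup>+x. (\<Sum>n. ennreal (F n x)) \<partial>unit_measure) = (\<Sum>n. \<integral>\<^sup>+x. ennreal (F n x) \<partial>unit_measure)"
    by (intro nn_integral_suminf meas)
  also have "\<dots> \<le> (\<Sum>n. ennreal (c n))"
    by (intro suminf_le)
      (auto simp: nn_integral_eq_integral[OF integrable_unit[OF cont]] nonneg intro!: ennreal_leI bound)
  also have "\<dots> = ennreal (suminf c)"
    using c assms(4) by (intro suminf_ennreal2) auto
  also have "\<dots> < \<infinity>" by simp
  finally have "AE x in unit_measure. (\<Sum>n. ennreal (F n x)) \<noteq> \<infinity>"
    by (intro nn_integral_noteq_infinite borel_measurable_suminf_order meas) auto
  then show ?thesis
    by (rule AE_mp) (auto intro!: AE_I2 summable_suminf_not_top nonneg)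
qed

lemma AE_unit_iff_negligible:
  "(AE x in unit_measure. P x) \<longleftrightarrow> negligible {x \<in> {0<..<1}. \<not> P x}"
proof -
  have "(AE x in unit_measure. P x) \<longleftrightarrow> (AE x in lebesgue. x \<in> {0<..<1} \<longrightarrow> P x)"
    by (subst AE_restrict_space_iff) auto
  also have "\<dots> \<longleftrightarrow> negligible {x. \<not> (x \<in> {0<..<1} \<longrightarrow> P x)}"
    using negligible_subset by (auto simp: eventually_ae_filter_negligible)
  finally show ?thesis by (simp add: conj_ac)
qed

lemma negligible_affine_image:
  fixes N :: "real set"
  assumes "negligible N"
  shows "negligible ((\<lambda>y. a * y + b) ` N)"
  using assms
  by (intro negligible_differentiable_image_negligible) (auto intro!: derivative_intros)

text \<open>The exceptional set of the dilated statement lies in finitely many scaled translates of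
  the original null set, one for each integer part of \<open>n x\<close>, together with finitely
  many points.\<close>

lemma AE_dilate_periodic:
  assumes ae: "AE x in unit_measure. P x"
    and per: "\<And>x i. P x \<Longrightarrow> P (x + of_int i)" and "n \<ge> 1"
  shows "AE x in unit_measure. P (real n * x)"
proof -
  define N where "N = {x \<in> {0<..<1}. \<not> P x}"
  \<comment> \<open>\<open>N\<close> lives in the open interval and says nothing about fractional
    part 0, so the points \<open>i / n\<close> are added separately.\<close>
  define B where "B = (\<Union>i\<in>{0..int n}. (\<lambda>y. (1 / real n) * y + of_int i / real n) ` N) \<union>
    (\<lambda>i. of_int i / real n) ` {0..int n}"
  have "negligible N" using ae by (simp add: AE_unit_iff_negligible N_def)
  then have "negligible B"
    unfolding B_def
  proof (intro negligible_Un negligible_Union)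
    fix t assume "negligible N" "t \<in> (\<lambda>i. (\<lambda>y. (1 / real n) * y + of_int i / real n) ` N) ` {0..int n}"
    then show "negligible t" by (elim imageE) (simp only: negligible_affine_image)
  qed auto
  moreover have "{x \<in> {0<..<1}. \<not> P (real n * x)} \<subseteq> B"
  proof
    fix x assume "x \<in> {x \<in> {0<..<1}. \<not> P (real n * x)}"
    then have x: "0 < x" "x < 1" "\<not> P (real n * x)" by auto
    define i where "i = \<lfloor>real n * x\<rfloor>"
    define y where "y = real n * x - of_int i"
    have nx: "0 \<le> real n * x" "real n * x \<le> real n"
      using x by (auto intro: mult_left_le)
    have i: "i \<in> {0..int n}"
      using nx unfolding i_def by (auto simp: floor_le_iff)
    have y: "0 \<le> y" "y < 1" unfolding y_def i_def by linarith+
    have "real n * x = y + of_int i" by (simp add: y_def)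
    then have "\<not> P y"
      using x(3) per[of y i] by auto
    have x_eq: "x = (1 / real n) * y + of_int i / real n"
      using \<open>n \<ge> 1\<close> by (simp add: y_def diff_divide_distrib)
    show "x \<in> B"
    proof (cases "y = 0")
      case True
      then show ?thesis using i x_eq unfolding B_def by auto
    next
      case False
      then have "y \<in> N" using y \<open>\<not> P y\<close> by (auto simp: N_def)
      then show ?thesis using i x_eq unfolding B_def by blast
    qed
  qed
  ultimately show ?thesis
    unfolding AE_unit_iff_negligible by (rule negligible_subset)
qed

text \<open>
  Cosine polynomials are uniformly dense in the continuous functions on \<open>[0, 1/2]\<close>, hence some
  bounded sequence of them converges almost everywhere to the sign of the given function.
\<close>

lemma AE_eq_0_of_orthogonal_cos_polys:
  assumes d: "integrable unit_measure d" and refl: "\<And>x. d (1 - x) = d x"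
    and orth: "\<And>F e. F \<in> cos_polys e \<Longrightarrow> integral\<^sup>L unit_measure (\<lambda>x. d x * F x) = 0"
  shows "AE x in unit_measure. d x = 0"
proof -
  have "(\<lambda>x. sgn (d x)) \<in> borel_measurable unit_measure"
    using d by (intro measurable_compose[OF _ borel_measurable_sgn]) auto
  then have "(\<lambda>x. sgn (d x)) measurable_on {0<..<1}"
    by (subst measurable_on_iff_borel_measurable) auto
  then obtain N G where N: "negligible N" and G: "\<And>n. continuous_on UNIV (G n)"
    and lim: "\<And>x. x \<notin> N \<Longrightarrow> (\<lambda>n. G n x) \<longlonglongrightarrow> (if x \<in> {0<..<1} then sgn (d x) else 0)"
    unfolding measurable_on_def by blast
  \<comment> \<open>Clipping keeps the limit, as \<open>sgn\<close> takes values in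
    \<open>[-1, 1]\<close>, and supplies the uniform bound for dominated convergence.\<close>
  define H where "H = (\<lambda>n x. max (-1) (min 1 (G n x)))"
  have contH: "continuous_on S (H n)" for n S
    unfolding H_def by (intro continuous_intros continuous_on_subset[OF G]) auto
  \<comment> \<open>\<open>cosine 1\<close> separates the points of \<open>[0, 1/2]\<close> because
    cos is injective on \<open>[0, pi]\<close>; on the whole unit interval the symmetry about 1/2
    would prevent this.\<close>
  interpret function_ring_on "\<Union>e. cos_polys e" "{0..1 / 2 :: real}"
  proof
    fix f assume "f \<in> (\<Union>e. cos_polys e)"
    then show "continuous_on {0..1 / 2} f" by (auto intro: continuous_cos_polys)
  next
    fix f g assume "f \<in> (\<Union>e. cos_polys e)" "g \<in> (\<Union>e. cos_polys e)"
    then obtain e e' where fg: "f \<in> cos_polys e" "g \<in> cos_polys e'" by auto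
    then have "f \<in> cos_polys (max e e')" "g \<in> cos_polys (max e e')"
      by (auto elim: cos_polys_mono)
    then show "(\<lambda>x. f x + g x) \<in> (\<Union>e. cos_polys e)"
      using cos_polys_add by blast
    show "(\<lambda>x. f x * g x) \<in> (\<Union>e. cos_polys e)"
      using cos_polys_mult[OF fg] by blast
  next
    fix x y :: real assume xy: "x \<in> {0..1 / 2}" "y \<in> {0..1 / 2}" "x \<noteq> y"
    then have "2 * pi * x \<le> 2 * pi * (1 / 2)" "2 * pi * y \<le> 2 * pi * (1 / 2)"
      by (auto intro!: mult_left_mono)
    then have "cosine 1 x \<noteq> cosine 1 y"
      using xy cos_inj_pi[of "2 * pi * x" "2 * pi * y"] by auto
    moreover have "cosine 1 \<in> cos_polys 1" using cos_polys_cosine[of 1 1 1] by simp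
    ultimately show "\<exists>f\<in>\<Union>e. cos_polys e. f x \<noteq> f y"
      by (intro bexI[where x="cosine 1"] UN_I[of 1] UNIV_I)
  qed (auto intro: cos_polys_const)
  have "\<exists>F e. F \<in> cos_polys e \<and> (\<forall>x\<in>{0..1 / 2}. \<bar>H n x - F x\<bar> < 1 / real (Suc n))" for n
    using Stone_Weierstrass_basic[OF contH[of _ n], of "1 / real (Suc n)"] by auto
  then obtain F e where F: "\<And>n. F n \<in> cos_polys (e n)"
    and close: "\<And>n x. x \<in> {0..1 / 2} \<Longrightarrow> \<bar>H n x - F n x\<bar> < 1 / real (Suc n)"
    by metis
  \<comment> \<open>Symmetry transfers every statement from the folded point
    \<open>min x (1 - x)\<close> in \<open>[0, 1/2]\<close> back to \<open>x\<close>.\<close>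
  have half: "F n x = F n (min x (1 - x))" "d x = d (min x (1 - x))" for n x
    using cos_polys_reflect[OF F[of n], of x] refl[of x] by (auto simp: min_def)
  have bounded: "\<bar>F n x\<bar> \<le> 2" if "x \<in> {0<..<1}" for n x
  proof -
    let ?y = "min x (1 - x)"
    have "\<bar>H n ?y - F n ?y\<bar> < 1 / real (Suc n)" using that by (intro close) (auto simp: min_def)
    moreover have "1 / real (Suc n) \<le> 1" by simp
    moreover have "\<bar>H n ?y\<bar> \<le> 1" by (auto simp: H_def)
    ultimately show ?thesis unfolding half(1)[of n x] by linarith
  qed
  \<comment> \<open>The folded point may be \<open>1 - x\<close>, so the reflection of
    \<open>N\<close> is excluded as well.\<close>
  have conv: "(\<lambda>n. F n x) \<longlonglongrightarrow> sgn (d x)" if "x \<in> {0<..<1}" "x \<notin> N \<union> (\<lambda>y. (-1) * y + 1) ` N" for x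
  proof -
    define y where "y = min x (1 - x)"
    have y: "y \<in> {0<..1 / 2}" using that by (auto simp: y_def min_def)
    have "1 - x \<notin> N"
    proof
      assume "1 - x \<in> N"
      then have "(-1) * (1 - x) + 1 \<in> (\<lambda>y. (-1) * y + 1) ` N" by (rule imageI)
      then show False using that(2) by simp
    qed
    then have "y \<notin> N"
      using that(2) by (auto simp: y_def min_def)
    then have "(\<lambda>n. G n y) \<longlonglongrightarrow> sgn (d y)" using lim[of y] y by simp
    then have "(\<lambda>n. H n y) \<longlonglongrightarrow> max (-1) (min 1 (sgn (d y)))"
      unfolding H_def by (intro tendsto_intros)
    also have "max (-1) (min 1 (sgn (d y))) = sgn (d y)" by (auto simp: sgn_if)
    finally have "(\<lambda>n. H n y) \<longlonglongrightarrow> sgn (d y)" .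
    moreover have "(\<lambda>n. H n y - F n y) \<longlonglongrightarrow> 0"
    proof (rule Lim_null_comparison)
      show "(\<lambda>n. 1 / real (Suc n)) \<longlonglongrightarrow> 0" by real_asymp
      show "\<forall>\<^sub>F n in sequentially. norm (H n y - F n y) \<le> 1 / real (Suc n)"
        using close[of y] y by (auto intro!: always_eventually less_imp_le)
    qed
    ultimately have "(\<lambda>n. H n y - (H n y - F n y)) \<longlonglongrightarrow> sgn (d y) - 0"
      by (rule tendsto_diff)
    then show ?thesis unfolding half(1)[of _ x] half(2)[of x] by (simp add: y_def)
  qed
  have "AE x in unit_measure. (\<lambda>n. F n x) \<longlonglongrightarrow> sgn (d x)"
    unfolding AE_unit_iff_negligible
    by (rule negligible_subset[OF negligible_Un[OF N negligible_affine_image[OF N, of "-1" 1]]])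
      (use conv in blast)
  then have ae: "AE x in unit_measure. (\<lambda>n. d x * F n x) \<longlonglongrightarrow> d x * sgn (d x)"
    by (rule AE_mp) (auto intro!: AE_I2 tendsto_intros)
  have meas: "d \<in> borel_measurable unit_measure" using d by simp
  have "(\<lambda>n. integral\<^sup>L unit_measure (\<lambda>x. d x * F n x)) \<longlonglongrightarrow>
      integral\<^sup>L unit_measure (\<lambda>x. d x * sgn (d x))"
  proof (rule integral_dominated_convergence[where w = "\<lambda>x. \<bar>d x\<bar> * 2"])
    show "AE x in unit_measure. norm (d x * F n x) \<le> \<bar>d x\<bar> * 2" for n
      by (auto simp: AE_restrict_space_iff abs_mult intro!: mult_left_mono bounded)
    show "(\<lambda>x. d x * F n x) \<in> borel_measurable unit_measure" for n
      by (intro borel_measurable_times[OF meas borel_measurable_unit] continuous_cos_polys[OF F])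
    show "(\<lambda>x. d x * sgn (d x)) \<in> borel_measurable unit_measure"
      by (intro borel_measurable_times meas measurable_compose[OF meas borel_measurable_sgn])
  qed (use d ae in auto)
  then have "integral\<^sup>L unit_measure (\<lambda>x. d x * sgn (d x)) = 0"
    using orth[OF F] by (simp add: LIMSEQ_const_iff)
  then have "integral\<^sup>L unit_measure (\<lambda>x. \<bar>d x\<bar>) = 0"
    by (simp add: abs_sgn mult.commute)
  then have "AE x in unit_measure. \<bar>d x\<bar> = 0"
    by (subst (asm) integral_nonneg_eq_0_iff_AE) (use d in auto)
  then show ?thesis by simp
qed

section \<open>Almost everywhere expansion of an even function into its dyadic blocks\<close>

context cosine_coeffs
begin

lemma summable_sqrt_half: "summable (\<lambda>k. sqrt (1 / 2) ^ k)"
proof -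
  have "sqrt (1 / 2) < 1" by (subst real_sqrt_lt_1_iff) simp
  then show ?thesis by (intro summable_geometric) simp
qed

text \<open>The L1 norms of the blocks are summable, so their sum \<open>h\<close> is integrable and
  its cosine coefficients may be computed term by term. They agree with those of \<open>f\<close>,
  hence \<open>f - h\<close> is orthogonal to all cosine polynomials and vanishes almost
  everywhere.\<close>

lemma AE_eq_dyadic_series:
  assumes f: "integrable unit_measure f" and refl: "\<And>x. f (1 - x) = f x"
    and mean: "integral\<^sup>L unit_measure f = 0"
    and coeffs: "\<And>j. j \<ge> 1 \<Longrightarrow> integral\<^sup>L unit_measure (\<lambda>x. f x * cosine j x) = a j / 2"
  shows "AE x in unit_measure. summable (\<lambda>k. \<bar>g k x\<bar>) \<and> f x = (\<Sum>k. g k x)"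
proof -
  define h where "h = (\<lambda>x. \<Sum>k. g k x)"
  have int: "integrable unit_measure (\<lambda>x. g k x * cosine j x)" for k j
    by (intro integrable_unit continuous_intros)
  have g_int: "integral\<^sup>L unit_measure (\<lambda>x. \<bar>g k x\<bar>) \<le> sqrt (1 / 2) ^ k" for k
    using integral_abs_g_dilate[of 1 k] by simp
  have ae: "AE x in unit_measure. summable (\<lambda>k. \<bar>g k x\<bar>)"
    by (rule AE_summable_of_integrals[OF _ _ g_int summable_sqrt_half]) (auto intro!: continuous_intros)
  have g_cos: "\<bar>g k x * cosine j x\<bar> \<le> \<bar>g k x\<bar>" for k j x
    by (simp add: abs_mult mult_left_le)
  have 1: "AE x in unit_measure. summable (\<lambda>k. norm (g k x * cosine j x))" for j
    using ae by (rule eventually_mono) (erule summable_comparison_test'[where N=0], simp only: real_norm_def abs_abs g_cos)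
  have 2: "summable (\<lambda>k. \<integral>x. norm (g k x * cosine j x) \<partial>unit_measure)" for j
  proof (rule summable_comparison_test'[OF summable_sqrt_half, of 0])
    fix k :: nat
    have "(\<integral>x. norm (g k x * cosine j x) \<partial>unit_measure) \<le> (\<integral>x. \<bar>g k x\<bar> \<partial>unit_measure)"
      using g_cos by (intro integral_unit_mono) (auto intro!: continuous_intros)
    then show "norm (\<integral>x. norm (g k x * cosine j x) \<partial>unit_measure) \<le> sqrt (1 / 2) ^ k"
      using g_int[of k] by simp
  qed
  have h_cos: "AE x in unit_measure. (\<Sum>k. g k x * cosine j x) = h x * cosine j x" for j
    using ae unfolding h_def
    by (rule eventually_mono) (rule suminf_mult2[symmetric], erule summable_rabs_cancel)
  have h: "integrable unit_measure h"
    using integrable_suminf[OF int 1 2, of 0] by (simp add: h_def)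
  have h_meas: "h \<in> borel_measurable unit_measure" using h by simp
  have h_coeff: "integral\<^sup>L unit_measure (\<lambda>x. h x * cosine j x) = (if j = 0 then 0 else a j / 2)" for j
  proof -
    have "integral\<^sup>L unit_measure (\<lambda>x. h x * cosine j x) =
        integral\<^sup>L unit_measure (\<lambda>x. \<Sum>k. g k x * cosine j x)"
    proof (rule integral_cong_AE)
      show "(\<lambda>x. h x * cosine j x) \<in> borel_measurable unit_measure"
        by (intro borel_measurable_times h_meas borel_measurable_unit continuous_intros)
      show "(\<lambda>x. \<Sum>k. g k x * cosine j x) \<in> borel_measurable unit_measure"
        using integrable_suminf[OF int 1 2, of j] by simp
      show "AE x in unit_measure. h x * cosine j x = (\<Sum>k. g k x * cosine j x)"
        using h_cos[of j] by (rule eventually_mono) simp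
    qed
    also have "\<dots> = (\<Sum>k. if j \<in> {2^k..<2^(k+1)} then a j / 2 else 0)"
      unfolding integral_suminf[OF int 1 2] integral_g_cosine ..
    \<comment> \<open>Each frequency \<open>j \<ge> 1\<close> lies in exactly one dyadic
      block.\<close>
    also have "\<dots> = (if j = 0 then 0 else a j / 2)"
    proof (cases "j = 0")
      case False
      then obtain k where k: "2 ^ k \<le> j" "j < 2 ^ (k + 1)"
        using ex_power_ivl1[of 2 j] by auto
      have unique: "k' = k" if "2 ^ k' \<le> j" "j < 2 ^ (k' + 1)" for k'
      proof -
        have "(2::nat) ^ k < 2 ^ (k' + 1)" "(2::nat) ^ k' < 2 ^ (k + 1)"
          using that k by linarith+
        then have "k < k' + 1" "k' < k + 1"
          by (auto simp only: power_strict_increasing_iff)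
        then show ?thesis by simp
      qed
      have "(\<lambda>k. if j \<in> {2^k..<2^(k+1)} then a j / 2 else 0) = (\<lambda>k'. if k' = k then a j / 2 else 0)"
      proof
        fix k'
        have "j \<in> {2^k'..<2^(k'+1)} \<longleftrightarrow> k' = k"
          using k unique[of k'] by (auto simp del: power_Suc)
        then show "(if j \<in> {2^k'..<2^(k'+1)} then a j / 2 else 0) = (if k' = k then a j / 2 else 0)"
          by simp
      qed
      then show ?thesis using sums_unique[OF sums_single[of k "\<lambda>_. a j / 2"]] False by simp
    qed simp
    finally show ?thesis .
  qed
  have d: "integrable unit_measure (\<lambda>x. f x - h x)" using f h by simp
  have "AE x in unit_measure. f x - h x = 0"
  proof (rule AE_eq_0_of_orthogonal_cos_polys[OF d])
    fix x
    have "h (1 - x) = h x"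
      unfolding h_def using cos_polys_reflect[OF g_cos_polys] by simp
    then show "f (1 - x) - h (1 - x) = f x - h x" using refl by simp
  next
    fix F e assume "F \<in> cos_polys e"
    then obtain b where b: "F = (\<lambda>x. \<Sum>j\<le>e. b j * cosine j x)" by (auto simp: cos_polys_def)
    have mult_int: "integrable unit_measure (\<lambda>x. v x * cosine j x)"
      if "integrable unit_measure v" for v :: "real \<Rightarrow> real" and j
    proof (rule Bochner_Integration.integrable_bound[OF that])
      show "(\<lambda>x. v x * cosine j x) \<in> borel_measurable unit_measure"
        by (intro borel_measurable_times[OF borel_measurable_integrable[OF that] borel_measurable_unit]
            continuous_intros)
      show "AE x in unit_measure. norm (v x * cosine j x) \<le> norm (v x)"
        by (auto intro!: AE_I2 simp: abs_mult mult_left_le)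
    qed
    have "integral\<^sup>L unit_measure (\<lambda>x. (f x - h x) * cosine j x) = 0" for j
    proof -
      have "integral\<^sup>L unit_measure (\<lambda>x. (f x - h x) * cosine j x) =
          integral\<^sup>L unit_measure (\<lambda>x. f x * cosine j x) - integral\<^sup>L unit_measure (\<lambda>x. h x * cosine j x)"
        unfolding left_diff_distrib by (intro Bochner_Integration.integral_diff mult_int f h)
      then show ?thesis using h_coeff[of j] coeffs[of j] mean by (cases "j = 0") auto
    qed
    moreover have "integral\<^sup>L unit_measure (\<lambda>x. (f x - h x) * F x) =
        (\<Sum>j\<le>e. b j * integral\<^sup>L unit_measure (\<lambda>x. (f x - h x) * cosine j x))"
      unfolding b sum_distrib_left mult.left_commute[of _ "b _"]
      using mult_int[OF d] by (subst Bochner_Integration.integral_sum) auto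
    ultimately show "integral\<^sup>L unit_measure (\<lambda>x. (f x - h x) * F x) = 0" by simp
  qed
  with ae show ?thesis by (auto simp: h_def)
qed

end

section \<open>Chaining over dyadic blocks\<close>

text \<open>The binary digits of \<open>M\<close> cut \<open>{1..M}\<close> into dyadic blocks, at
  most one of each length \<open>2^h\<close>: the block of that length is present exactly when digit
  \<open>h\<close> is 1.\<close>

lemma dyadic_chaining:
  fixes y T :: "nat \<Rightarrow> real"
  assumes M: "M < 2 ^ (n + 1)"
    and T_nonneg: "\<And>h. T h \<ge> 0"
    and block: "\<And>h b. h \<le> n \<Longrightarrow> b < 2 ^ (n + 1 - h) \<Longrightarrow> \<bar>\<Sum>l\<in>{b * 2^h<..b * 2^h + 2^h}. y l\<bar> \<le> T h"
  shows "\<bar>\<Sum>l=1..M. y l\<bar> \<le> (\<Sum>h\<le>n. T h)"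
proof -
  \<comment> \<open>The sum up to \<open>M\<close> with its \<open>h\<close> lowest binary digits
    erased: \<open>F 0\<close> is the full sum, and \<open>F (n + 1)\<close> is empty since
    \<open>M < 2^(n+1)\<close>.\<close>
  define F where "F = (\<lambda>h. \<Sum>l\<in>{0<..M div 2^h * 2^h}. y l)"
  have step: "\<bar>F h\<bar> \<le> T h + \<bar>F (Suc h)\<bar>" if "h \<le> n" for h
  proof -
    define c where "c = M div 2 ^ Suc h"
    have c: "c = M div 2 ^ h div 2" by (simp only: c_def power_Suc2 div_mult2_eq)
    show ?thesis
    proof (cases "even (M div 2 ^ h)")
      case True
      then have "M div 2 ^ h = 2 * c" unfolding c by simp
      then have "F h = F (Suc h)" unfolding F_def c_def[symmetric] by (simp add: mult_ac)
      then show ?thesis using T_nonneg by simp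
    next
      case False
      then have b: "M div 2 ^ h = 2 * c + 1" unfolding c by simp
      have "M < 2 ^ (n + 1 - h) * 2 ^ h" using M that by (simp flip: power_add)
      then have "M div 2 ^ h < 2 ^ (n + 1 - h)" by (simp add: less_mult_imp_div_less)
      then have lt: "2 * c < 2 ^ (n + 1 - h)" using b by linarith
      have "{0<..M div 2^h * 2^h} = {0<..c * 2 ^ Suc h} \<union> {2 * c * 2^h<..2 * c * 2^h + 2^h}"
        unfolding b by (auto simp: algebra_simps)
      then have "F h = F (Suc h) + (\<Sum>l\<in>{2 * c * 2^h<..2 * c * 2^h + 2^h}. y l)"
        unfolding F_def c_def[symmetric] by (simp add: sum.union_disjoint)
      then show ?thesis using block[OF that lt] by linarith
    qed
  qed
  have "m \<le> n + 1 \<Longrightarrow> \<bar>F 0\<bar> \<le> (\<Sum>h<m. T h) + \<bar>F m\<bar>" for m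
  proof (induction m)
    case (Suc m)
    then show ?case using step[of m] by simp
  qed simp
  from this[of "n + 1"] have "\<bar>F 0\<bar> \<le> (\<Sum>h\<le>n. T h)"
    using M by (simp add: F_def lessThan_Suc_atMost)
  moreover have "F 0 = (\<Sum>l=1..M. y l)"
    unfolding F_def by (intro sum.cong) auto
  ultimately show ?thesis by simp
qed

lemma sum_power_le:
  fixes x :: real
  assumes "0 \<le> x" "x < 1"
  shows "(\<Sum>i\<le>n. x ^ i) \<le> 1 / (1 - x)"
  using assms unfolding lessThan_Suc_atMost[symmetric]
  by (subst sum_gp_strict) (auto intro!: divide_right_mono)

text \<open>110 is the value \<open>x / (1 - x)^2\<close> of the infinite series at
  \<open>x = 10/11\<close>; the term subtracted in the proof is the exact remainder.\<close>

lemma sum_mult_power_le: "(\<Sum>i\<le>n. real i * (10 / 11) ^ i) \<le> 110"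
proof -
  have "(\<Sum>i\<le>n. real i * (10 / 11) ^ i) = 110 - (10 / 11) ^ n * (10 * real n + 110)"
    by (induction n) (simp_all add: field_simps)
  then show ?thesis by simp
qed

section \<open>Thresholds and chaining for the low frequencies, then summation of the high
  frequencies\<close>

context lacunary_cosine
begin

definition D :: real where "D = 31 * real r"

text \<open>A compromise: a linear gap above \<open>n\<close> makes the remaining blocks summable in
  L1, while 5 percent is small enough for the condition of \<open>interval_moment\<close> to hold
  with \<open>\<theta> = lam n i\<close>.\<close>

definition cutoff :: "nat \<Rightarrow> nat" where "cutoff n = n + n div 20 + 1"

text \<open>The exponential parameter for blocks of length \<open>2^(n - i)\<close>. At
  \<open>i = 0\<close> it has the order of the minimiser of \<open>t D 2^n + 2 ln n / t\<close>; the
  factor \<open>(11/10)^i\<close> makes the main parts of \<open>threshold n i\<close> decay like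
  \<open>(11/20)^i\<close> and \<open>(10/11)^i\<close>.\<close>

definition lam :: "nat \<Rightarrow> nat \<Rightarrow> real" where
  "lam n i = 3 * sqrt (ln (real n) / (D * 2 ^ n)) * (11 / 10) ^ i"

text \<open>Chosen so that the exponential Markov inequality leaves
  \<open>3 exp (- (2 ln n + i))\<close>: the factor \<open>exp (- i)\<close> beats the
  \<open>2^(i+1)\<close> blocks of level \<open>i\<close>, and \<open>n^(-2)\<close> is
  summable.\<close>

definition threshold :: "nat \<Rightarrow> nat \<Rightarrow> real" where
  "threshold n i = lam n i * D * 2 ^ (n - i) + (2 * ln (real n) + real i) / lam n i"

definition block_sum :: "nat \<Rightarrow> nat \<Rightarrow> nat \<Rightarrow> real \<Rightarrow> real" where
  "block_sum n i b x =
    (\<Sum>l\<in>{b * 2^(n - i)<..b * 2^(n - i) + 2^(n - i)}. \<Sum>k<cutoff n. g k (real (s l) * x))"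

text \<open>A sum of nonnegative Markov majorants for both signs. A block sum beyond its threshold
  makes one term at least 1, so \<open>excess n x < 1\<close> forces all blocks of stage
  \<open>n\<close> below their thresholds.\<close>

definition excess :: "nat \<Rightarrow> real \<Rightarrow> real" where
  "excess n x = (\<Sum>i\<le>n. \<Sum>b<2^(i+1).
    exp (lam n i * block_sum n i b x - lam n i * threshold n i) +
    exp (- lam n i * block_sum n i b x - lam n i * threshold n i))"

lemma D_ge: "D \<ge> 31"
  using r_pos by (simp add: D_def)

lemma lam_pos: "n \<ge> 2 \<Longrightarrow> lam n i > 0"
  using D_ge by (simp add: lam_def)

lemma threshold_nonneg: "n \<ge> 2 \<Longrightarrow> threshold n i \<ge> 0"
  using lam_pos[of n i] D_ge by (simp add: threshold_def)

lemma integral_excess: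
  assumes n: "n \<ge> 2"
    and small: "\<And>i k. i \<le> n \<Longrightarrow> k < cutoff n \<Longrightarrow> lam n i * (real (r * (k + 2)) * 5 * (5 / 4) ^ k) \<le> 1"
  shows "integral\<^sup>L unit_measure (excess n) \<le> 60 * (1 / (real n)\<^sup>2)"
proof -
  define e where "e = (\<lambda>i. exp (- (2 * ln (real n) + real i)))"
  have one: "integral\<^sup>L unit_measure (\<lambda>x. exp (\<theta> * block_sum n i b x - lam n i * threshold n i)) \<le> 3 * e i"
    if "i \<le> n" "\<theta> = lam n i \<or> \<theta> = - lam n i" for i b \<theta>
  proof -
    let ?N = "2 ^ (n - i) :: nat"
    have abs: "\<bar>\<theta>\<bar> = lam n i" and sq: "\<theta>\<^sup>2 = (lam n i)\<^sup>2"
      using that(2) lam_pos[OF n, of i] by auto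
    have "integral\<^sup>L unit_measure (\<lambda>x. exp (\<theta> * block_sum n i b x)) \<le> 3 * exp (\<theta>\<^sup>2 * (31 * real r) * real ?N)"
      unfolding block_sum_def by (rule interval_moment) (use small that(1) abs in simp)
    moreover have "lam n i * threshold n i = \<theta>\<^sup>2 * (31 * real r) * real ?N + (2 * ln (real n) + real i)"
      using lam_pos[OF n, of i] unfolding sq threshold_def distrib_left
      by (simp add: D_def power2_eq_square mult_ac)
    ultimately show ?thesis
      unfolding e_def by (simp add: exp_diff exp_minus exp_add field_simps)
  qed
  have cont: "continuous_on UNIV (block_sum n i b)" for i b
    unfolding block_sum_def by (intro continuous_intros)
  have int: "integrable unit_measure (\<lambda>x. exp (\<theta> * block_sum n i b x - c))" for \<theta> c i b
    by (intro integrable_unit continuous_intros cont)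
  have "integral\<^sup>L unit_measure (excess n) = (\<Sum>i\<le>n. integral\<^sup>L unit_measure (\<lambda>x. \<Sum>b<2^(i+1).
      exp (lam n i * block_sum n i b x - lam n i * threshold n i) +
      exp (- lam n i * block_sum n i b x - lam n i * threshold n i)))"
    unfolding excess_def
    by (intro Bochner_Integration.integral_sum Bochner_Integration.integrable_sum
        Bochner_Integration.integrable_add int)
  also have "\<dots> = (\<Sum>i\<le>n. \<Sum>b<2^(i+1). integral\<^sup>L unit_measure (\<lambda>x.
      exp (lam n i * block_sum n i b x - lam n i * threshold n i) +
      exp (- lam n i * block_sum n i b x - lam n i * threshold n i)))"
    by (intro sum.cong refl Bochner_Integration.integral_sum Bochner_Integration.integrable_add int)
  also have "\<dots> = (\<Sum>i\<le>n. \<Sum>b<2^(i+1).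
      integral\<^sup>L unit_measure (\<lambda>x. exp (lam n i * block_sum n i b x - lam n i * threshold n i)) +
      integral\<^sup>L unit_measure (\<lambda>x. exp (- lam n i * block_sum n i b x - lam n i * threshold n i)))"
    by (intro sum.cong refl Bochner_Integration.integral_add int)
  also have "\<dots> \<le> (\<Sum>i\<le>n. \<Sum>b<2^(i+1)::nat. 3 * e i + 3 * e i)"
    by (intro sum_mono add_mono one) auto
  also have "\<dots> = (\<Sum>i\<le>n. 12 * (2 ^ i * e i))"
    by simp
  \<comment> \<open>With \<open>exp 1 \<ge> 5/2\<close>, \<open>2^i exp (- i) \<le> (4/5)^i\<close>;
    the geometric sum is at most 5, which yields \<open>12 * 5 = 60\<close>.\<close>
  also have "\<dots> \<le> (\<Sum>i\<le>n. 12 * ((4 / 5) ^ i * (1 / (real n)\<^sup>2)))"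
  proof (intro sum_mono mult_left_mono)
    fix i
    have "exp (1::real) \<ge> 5 / 2"
      using exp_lower_Taylor_quadratic[of 1] by simp
    then have "exp (-1::real) \<le> 2 / 5"
      by (simp add: exp_minus field_simps)
    then have "exp (-1::real) ^ i \<le> (2 / 5) ^ i"
      by (intro power_mono) auto
    then have e_le: "exp (- real i) \<le> (2 / 5) ^ i"
      by (simp add: exp_of_nat_mult[symmetric])
    have "exp (- (2 * ln (real n))) = 1 / (real n)\<^sup>2"
      using n by (simp add: exp_minus exp_double inverse_eq_divide)
    then have "e i = exp (- real i) * (1 / (real n)\<^sup>2)"
      unfolding e_def minus_add_distrib exp_add by simp
    also have "2 ^ i * \<dots> \<le> 2 ^ i * ((2 / 5) ^ i * (1 / (real n)\<^sup>2))"
      using e_le by (intro mult_left_mono mult_right_mono) auto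
    also have "\<dots> = (4 / 5) ^ i * (1 / (real n)\<^sup>2)"
    proof -
      have "(2::real) ^ i * (2 / 5) ^ i = (4 / 5) ^ i"
        by (simp flip: power_mult_distrib)
      then show ?thesis by (simp only: mult.assoc[symmetric])
    qed
    finally show "2 ^ i * e i \<le> (4 / 5) ^ i * (1 / (real n)\<^sup>2)" .
  qed auto
  also have "\<dots> = 12 * (1 / (real n)\<^sup>2) * (\<Sum>i\<le>n. (4 / 5) ^ i)"
    unfolding sum_distrib_left by (simp add: mult_ac)
  also have "\<dots> \<le> 12 * (1 / (real n)\<^sup>2) * (1 / (1 - 4 / 5))"
    by (intro mult_left_mono sum_power_le) auto
  finally show ?thesis by simp
qed

text \<open>Up to polynomial factors the left side is of order
  \<open>(2^(-1/2) * 11/10 * (5/4)^(21/20))^n\<close>, with base below 1. Rational bounds verify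
  this: 500/707 for \<open>2^(-1/2)\<close>, 253/250 for \<open>(5/4)^(1/20)\<close>, and 197/200
  for the whole base.\<close>

lemma eventually_lam_small:
  "\<forall>\<^sub>F n in sequentially. \<forall>i\<le>n. \<forall>k<cutoff n. lam n i * (real (r * (k + 2)) * 5 * (5 / 4) ^ k) \<le> 1"
proof -
  have "(\<lambda>n. (75 / 4 * real r) * (real n * (2 * real n + 3) * (197 / 200) ^ n)) \<longlonglongrightarrow> 75 / 4 * real r * 0"
    by (intro tendsto_mult_left) real_asymp
  then have ev: "\<forall>\<^sub>F n in sequentially. (75 / 4 * real r) * (real n * (2 * real n + 3) * (197 / 200) ^ n) < 1"
    by (rule order_tendstoD(2)) simp
  show ?thesis
    using ev eventually_ge_at_top[of 2]
  proof eventually_elim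
    case (elim n)
    show ?case
    proof (intro allI impI)
      fix i k assume i: "i \<le> n" and k: "k < cutoff n"
      have lam: "lam n i \<le> 3 * real n * (500 / 707) ^ n * (11 / 10) ^ n"
      proof -
        have "ln (real n) / (D * 2 ^ n) \<le> real n / (1 * 2 ^ n)"
          using elim(2) D_ge ln_bound[of "real n"]
          by (intro frac_le mult_right_mono) (auto simp: ln_bound)
        also have "\<dots> \<le> (real n)\<^sup>2 / 2 ^ n"
          using elim(2) by (simp add: power2_eq_square divide_right_mono)
        also have "\<dots> = (real n)\<^sup>2 * (1 / 2) ^ n"
          by (simp add: power_one_over)
        also have "\<dots> \<le> (real n)\<^sup>2 * ((500 / 707)\<^sup>2) ^ n"
          by (intro mult_left_mono power_mono) (auto simp: power2_eq_square)
        also have "\<dots> = (real n * (500 / 707) ^ n)\<^sup>2"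
          by (simp add: power_mult_distrib power_mult[symmetric] mult.commute del: power_divide)
        finally have "sqrt (ln (real n) / (D * 2 ^ n)) \<le> real n * (500 / 707) ^ n"
          by (intro real_le_lsqrt) auto
        moreover have "(11 / 10 :: real) ^ i \<le> (11 / 10) ^ n"
          using i by (intro power_increasing) auto
        ultimately have "lam n i \<le> 3 * (real n * (500 / 707) ^ n) * (11 / 10) ^ n"
          unfolding lam_def using elim(2) D_ge by (intro mult_mono) auto
        then show ?thesis by (simp add: mult_ac)
      qed
      have pow: "(5 / 4 :: real) ^ k \<le> 5 / 4 * (253 / 200) ^ n"
      proof -
        have "(5 / 4 :: real) ^ k \<le> (5 / 4) ^ cutoff n"
          using k by (intro power_increasing) auto
        also have "\<dots> = 5 / 4 * (5 / 4) ^ n * (5 / 4) ^ (n div 20)"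
          by (simp add: cutoff_def power_add)
        also have "(5 / 4 :: real) ^ (n div 20) \<le> ((253 / 250) ^ 20) ^ (n div 20)"
          by (intro power_mono) (auto simp: power_divide)
        also have "\<dots> = (253 / 250 :: real) ^ (20 * (n div 20))"
          by (simp only: power_mult)
        also have "\<dots> \<le> (253 / 250) ^ n"
          by (intro power_increasing) auto
        finally have "(5 / 4 :: real) ^ k \<le> 5 / 4 * ((5 / 4) ^ n * (253 / 250) ^ n)"
          by simp
        then show ?thesis by (simp flip: power_mult_distrib)
      qed
      have "k + 2 \<le> 2 * n + 3" using k by (simp add: cutoff_def)
      then have "real (k + 2) \<le> 2 * real n + 3" by linarith
      then have k': "real (r * (k + 2)) \<le> real r * (2 * real n + 3)"
        unfolding of_nat_mult by (intro mult_left_mono) auto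
      have "lam n i * (real (r * (k + 2)) * 5 * (5 / 4) ^ k) \<le>
          (3 * real n * (500 / 707) ^ n * (11 / 10) ^ n) * (real r * (2 * real n + 3) * 5 * (5 / 4 * (253 / 200) ^ n))"
        using lam pow k' by (intro mult_mono) auto
      also have "\<dots> = (75 / 4 * real r) * (real n * (2 * real n + 3) * ((500 / 707) ^ n * (11 / 10) ^ n * (253 / 200) ^ n))"
        by simp
      also have "\<dots> = (75 / 4 * real r) * (real n * (2 * real n + 3) * (500 / 707 * (11 / 10) * (253 / 200)) ^ n)"
        by (simp only: power_mult_distrib)
      also have "\<dots> \<le> (75 / 4 * real r) * (real n * (2 * real n + 3) * (197 / 200) ^ n)"
        by (intro mult_left_mono power_mono) auto
      also have "\<dots> \<le> 1" using elim(1) by simp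
      finally show "lam n i * (real (r * (k + 2)) * 5 * (5 / 4) ^ k) \<le> 1" .
    qed
  qed
qed

lemma AE_block_sums_le:
  "AE x in unit_measure. \<forall>\<^sub>F n in sequentially. \<forall>i\<le>n. \<forall>b<2^(i+1). \<bar>block_sum n i b x\<bar> \<le> threshold n i"
proof -
  obtain N where N: "N \<ge> 2" and
    small: "\<And>n i k. n \<ge> N \<Longrightarrow> i \<le> n \<Longrightarrow> k < cutoff n \<Longrightarrow> lam n i * (real (r * (k + 2)) * 5 * (5 / 4) ^ k) \<le> 1"
  proof -
    obtain N where "\<And>n. n \<ge> N \<Longrightarrow> \<forall>i\<le>n. \<forall>k<cutoff n. lam n i * (real (r * (k + 2)) * 5 * (5 / 4) ^ k) \<le> 1"
      using eventually_lam_small unfolding eventually_sequentially by auto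
    then show ?thesis by (intro that[of "max N 2"]) auto
  qed
  \<comment> \<open>The integral bound holds only from \<open>N\<close> on, so earlier terms are set
    to 0.\<close>
  define Y where "Y = (\<lambda>n x. if n \<ge> N then excess n x else 0)"
  have "AE x in unit_measure. summable (\<lambda>n. Y n x)"
  proof (rule AE_summable_of_integrals)
    show "continuous_on UNIV (Y n)" for n
      by (cases "n \<ge> N") (auto simp: Y_def excess_def block_sum_def intro!: continuous_intros)
    show "0 \<le> Y n x" for n x
      unfolding Y_def excess_def by (auto intro!: sum_nonneg add_nonneg_nonneg)
    show "integral\<^sup>L unit_measure (Y n) \<le> 60 * (1 / (real n)\<^sup>2)" for n
    proof (cases "n \<ge> N")
      case True
      then have "Y n = excess n" by (simp add: Y_def fun_eq_iff)
      then show ?thesis using integral_excess[of n] small[OF True] True N by simp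
    qed (simp add: Y_def)
    show "summable (\<lambda>n. 60 * (1 / (real n)\<^sup>2))"
      using inverse_power_summable[of 2, where 'a=real]
      by (intro summable_mult) (simp add: inverse_eq_divide)
  qed
  then show ?thesis
  proof (rule eventually_mono)
    fix x assume "summable (\<lambda>n. Y n x)"
    then have "(\<lambda>n. Y n x) \<longlonglongrightarrow> 0" by (rule summable_LIMSEQ_zero)
    then have "\<forall>\<^sub>F n in sequentially. Y n x < 1"
      by (auto dest!: order_tendstoD(2)[where a=1])
    then show "\<forall>\<^sub>F n in sequentially. \<forall>i\<le>n. \<forall>b<2^(i+1). \<bar>block_sum n i b x\<bar> \<le> threshold n i"
      using eventually_ge_at_top[of N]
    proof eventually_elim
      case (elim n)
      then have ex: "excess n x < 1" and n: "n \<ge> 2" using N by (auto simp: Y_def)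
      show ?case
      proof (intro allI impI)
        fix i b :: nat assume i: "i \<le> n" and b: "b < 2^(i+1)"
        define t where "t = (\<lambda>i b. exp (lam n i * block_sum n i b x - lam n i * threshold n i) +
          exp (- lam n i * block_sum n i b x - lam n i * threshold n i))"
        have t: "t i b \<ge> 0" for i b unfolding t_def by (intro add_nonneg_nonneg) auto
        have "t i b \<le> (\<Sum>b<2^(i+1). t i b)"
          using b t by (intro member_le_sum) auto
        also have "\<dots> \<le> (\<Sum>i\<le>n. \<Sum>b<2^(i+1). t i b)"
          using i t by (intro member_le_sum[of i "{..n}"] sum_nonneg) auto
        also have "\<dots> = excess n x" by (simp add: t_def excess_def)
        finally have "t i b < 1" using ex by simp
        then have "exp (lam n i * block_sum n i b x - lam n i * threshold n i) < exp 0"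
          "exp (- lam n i * block_sum n i b x - lam n i * threshold n i) < exp 0"
          unfolding t_def exp_zero by (smt (verit) exp_gt_zero)+
        then have "lam n i * block_sum n i b x < lam n i * threshold n i"
          "lam n i * (- block_sum n i b x) < lam n i * threshold n i"
          unfolding exp_less_cancel_iff by auto
        then have "block_sum n i b x < threshold n i" "- block_sum n i b x < threshold n i"
          using lam_pos[OF n, of i] by (simp_all only: mult_less_cancel_left_pos)
        then show "\<bar>block_sum n i b x\<bar> \<le> threshold n i" by linarith
      qed
    qed
  qed
qed

text \<open>In units of \<open>sqrt (D 2^n ln n)\<close> the geometric series sum to
  \<open>20/3 + 22/3 = 14\<close>; the part of the threshold linear in \<open>i\<close> leaves the
  correction that vanishes as \<open>n\<close> grows.\<close>

lemma sum_threshold_le: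
  assumes n: "n \<ge> 2"
  shows "(\<Sum>i\<le>n. threshold n i) \<le> sqrt (D * 2 ^ n * ln (real n)) * (14 + 110 / (3 * ln (real n)))"
proof -
  define Q where "Q = sqrt (D * 2 ^ n * ln (real n))"
  have ln: "ln (real n) > 0" using n by simp
  have Q: "Q > 0" "Q * Q = D * 2 ^ n * ln (real n)"
    using D_ge ln by (auto simp: Q_def)
  have sq: "sqrt (ln (real n) / (D * 2 ^ n)) = Q / (D * 2 ^ n)"
  proof (rule real_sqrt_unique)
    show "(Q / (D * 2 ^ n))\<^sup>2 = ln (real n) / (D * 2 ^ n)"
      using D_ge by (simp add: power2_eq_square Q(2))
  qed (use Q D_ge in auto)
  have th: "threshold n i = Q * (3 * (11 / 20) ^ i + (2 * (10 / 11) ^ i + (real i * (10 / 11) ^ i) / ln (real n)) / 3)"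
    if "i \<le> n" for i
  proof -
    have lam: "lam n i = 3 * Q / (D * 2 ^ n) * (11 / 10) ^ i"
      unfolding lam_def sq by simp
    have p: "(2::real) ^ n = 2 ^ (n - i) * 2 ^ i" using that by (simp flip: power_add)
    have 1: "lam n i * D * 2 ^ (n - i) = Q * (3 * (11 / 20) ^ i)"
    proof -
      have "(11 / 20 :: real) ^ i * 2 ^ i = (11 / 10) ^ i"
        by (simp flip: power_mult_distrib)
      then show ?thesis unfolding lam p using D_ge by (simp add: field_simps)
    qed
    have 2: "1 / lam n i = Q / ln (real n) * (10 / 11) ^ i / 3"
    proof -
      have "(10 / 11 :: real) ^ i * (11 / 10) ^ i = 1"
        by (simp flip: power_mult_distrib)
      then have "lam n i * (Q / ln (real n) * (10 / 11) ^ i / 3) = Q * Q / (D * 2 ^ n * ln (real n))"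
        unfolding lam by (simp add: field_simps)
      also have "\<dots> = 1" unfolding Q(2) using D_ge ln by simp
      finally show ?thesis using lam_pos[OF n, of i] Q(1) by (simp add: field_simps)
    qed
    have "(2 * ln (real n) + real i) / lam n i = (2 * ln (real n) + real i) * (1 / lam n i)" by simp
    also have "\<dots> = Q * ((2 * (10 / 11) ^ i + (real i * (10 / 11) ^ i) / ln (real n)) / 3)"
      unfolding 2 using ln by (simp add: field_simps)
    finally show ?thesis unfolding threshold_def 1 by (simp only: distrib_left)
  qed
  have "(\<Sum>i\<le>n. threshold n i) =
      (\<Sum>i\<le>n. Q * (3 * (11 / 20) ^ i + (2 * (10 / 11) ^ i + (real i * (10 / 11) ^ i) / ln (real n)) / 3))"
    by (intro sum.cong refl th) simp
  also have "\<dots> = Q * (3 * (\<Sum>i\<le>n. (11 / 20) ^ i) + (2 * (\<Sum>i\<le>n. (10 / 11) ^ i) + (\<Sum>i\<le>n. real i * (10 / 11) ^ i) / ln (real n)) / 3)"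
    by (simp only: sum_distrib_left[symmetric] sum.distrib sum_divide_distrib[symmetric])
  also have "\<dots> \<le> Q * (3 * (1 / (1 - 11 / 20)) + (2 * (1 / (1 - 10 / 11)) + 110 / ln (real n)) / 3)"
    using Q(1) ln
    by (intro mult_left_mono add_mono divide_right_mono sum_power_le sum_mult_power_le) auto
  also have "\<dots> = Q * (14 + 110 / (3 * ln (real n)))"
    by (simp add: field_simps)
  finally show ?thesis unfolding Q_def .
qed

lemma AE_truncated_sums_le:
  "AE x in unit_measure. \<forall>\<^sub>F n in sequentially. \<forall>M<2^(n+1).
    \<bar>\<Sum>l=1..M. \<Sum>k<cutoff n. g k (real (s l) * x)\<bar> \<le>
      sqrt (D * 2 ^ n * ln (real n)) * (14 + 110 / (3 * ln (real n)))"
  using AE_block_sums_le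
proof (rule eventually_mono)
  fix x
  assume "\<forall>\<^sub>F n in sequentially. \<forall>i\<le>n. \<forall>b<2^(i+1). \<bar>block_sum n i b x\<bar> \<le> threshold n i"
  then show "\<forall>\<^sub>F n in sequentially. \<forall>M<2^(n+1).
    \<bar>\<Sum>l=1..M. \<Sum>k<cutoff n. g k (real (s l) * x)\<bar> \<le>
      sqrt (D * 2 ^ n * ln (real n)) * (14 + 110 / (3 * ln (real n)))"
    using eventually_ge_at_top[of 2]
  proof eventually_elim
    case (elim n)
    show ?case
    proof (intro allI impI)
      fix M :: nat assume M: "M < 2 ^ (n + 1)"
      \<comment> \<open>Chaining indexes blocks by the exponent \<open>h\<close> of their length,
        the thresholds by the level \<open>i = n - h\<close>.\<close>
      have "\<bar>\<Sum>l=1..M. \<Sum>k<cutoff n. g k (real (s l) * x)\<bar> \<le> (\<Sum>h\<le>n. threshold n (n - h))"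
      proof (rule dyadic_chaining[OF M])
        show "0 \<le> threshold n (n - h)" for h by (rule threshold_nonneg[OF elim(2)])
        fix h b :: nat assume h: "h \<le> n" and b: "b < 2 ^ (n + 1 - h)"
        have "n + 1 - h = n - h + 1" "n - (n - h) = h" using h by auto
        then show "\<bar>\<Sum>l\<in>{b * 2^h<..b * 2^h + 2^h}. \<Sum>k<cutoff n. g k (real (s l) * x)\<bar> \<le> threshold n (n - h)"
          using elim(1)[rule_format, of "n - h" b] b unfolding block_sum_def by simp
      qed
      also have "\<dots> = (\<Sum>i\<le>n. threshold n i)"
        by (rule sum.reindex_bij_witness[where i="\<lambda>i. n - i" and j="\<lambda>i. n - i"]) auto
      also note sum_threshold_le[OF elim(2)]
      finally show "\<bar>\<Sum>l=1..M. \<Sum>k<cutoff n. g k (real (s l) * x)\<bar> \<le>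
          sqrt (D * 2 ^ n * ln (real n)) * (14 + 110 / (3 * ln (real n)))" .
    qed
  qed
qed

text \<open>For a fixed block \<open>k\<close> all stages \<open>n\<close> whose truncation omits it
  are collected, each normalised by \<open>2^(n/2)\<close>. A single series over \<open>k\<close>
  thus controls every stage at once.\<close>

definition tail :: "nat \<Rightarrow> real \<Rightarrow> real" where
  "tail k x = (\<Sum>n | cutoff n \<le> k. sqrt (1 / 2) ^ n * (\<Sum>l=1..2^(n+1). \<bar>g k (real (s l) * x)\<bar>))"

lemma cutoff_le_subset: "{n. cutoff n \<le> k} \<subseteq> {..k}"
  by (auto simp: cutoff_def)

lemma finite_cutoff_le: "finite {n. cutoff n \<le> k}"
  using cutoff_le_subset finite_subset by blast

text \<open>Stage \<open>n\<close> contributes at most \<open>2 * 2^(- (k - n) / 2)\<close> to the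
  integral; the gap \<open>k - n\<close> is at least \<open>k / 21\<close>, and there are at most
  \<open>k + 1\<close> stages.\<close>

lemma AE_summable_tail: "AE x in unit_measure. summable (\<lambda>k. tail k x)"
proof (rule AE_summable_of_integrals)
  define \<rho> where "\<rho> = root 21 (sqrt (1 / 2))"
  have h: "sqrt (1 / 2) < (1::real)" by (subst real_sqrt_lt_1_iff) simp
  have \<rho>: "\<rho> > 0" "\<rho> < 1" "\<rho> ^ 21 = sqrt (1 / 2)"
    using h by (simp_all add: \<rho>_def)
  show "continuous_on UNIV (tail k)" for k
    unfolding tail_def by (intro continuous_intros)
  show "0 \<le> tail k x" for k x
    unfolding tail_def by (intro sum_nonneg mult_nonneg_nonneg) auto
  show "integral\<^sup>L unit_measure (tail k) \<le> 2 * (real (Suc k) * \<rho> ^ k)" for k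
  proof -
    have int: "integrable unit_measure (\<lambda>x. c * \<bar>g k (real (s l) * x)\<bar>)" for c l
      by (intro integrable_unit continuous_intros)
    have "integral\<^sup>L unit_measure (tail k) = (\<Sum>n | cutoff n \<le> k.
        integral\<^sup>L unit_measure (\<lambda>x. \<Sum>l=1..2^(n+1). sqrt (1 / 2) ^ n * \<bar>g k (real (s l) * x)\<bar>))"
      unfolding tail_def sum_distrib_left
      by (intro Bochner_Integration.integral_sum Bochner_Integration.integrable_sum int)
    also have "\<dots> = (\<Sum>n | cutoff n \<le> k. \<Sum>l=1..2^(n+1). sqrt (1 / 2) ^ n *
        integral\<^sup>L unit_measure (\<lambda>x. \<bar>g k (real (s l) * x)\<bar>))"
      using int by (subst Bochner_Integration.integral_sum) auto
    also have "\<dots> \<le> (\<Sum>n | cutoff n \<le> k. \<Sum>l=1..2^(n+1)::nat. sqrt (1 / 2) ^ n * sqrt (1 / 2) ^ k)"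
      by (intro sum_mono mult_left_mono integral_abs_g_dilate) (use s_pos in \<open>auto simp: Suc_le_eq\<close>)
    also have "\<dots> = (\<Sum>n | cutoff n \<le> k. 2 * sqrt (1 / 2) ^ (k - n))"
    proof (intro sum.cong refl)
      fix n assume "n \<in> {n. cutoff n \<le> k}"
      then have "sqrt (1 / 2) ^ k = sqrt (1 / 2) ^ n * sqrt (1 / 2 :: real) ^ (k - n)"
        by (simp add: cutoff_def flip: power_add)
      moreover have "sqrt (1 / 2) ^ n * sqrt (1 / 2) ^ n * 2 ^ n = (1::real)"
        by (simp flip: power_mult_distrib)
      ultimately show "(\<Sum>l=1..2^(n+1)::nat. sqrt (1 / 2) ^ n * sqrt (1 / 2) ^ k) = 2 * sqrt (1 / 2) ^ (k - n)"
        by (simp add: mult_ac)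
    qed
    also have "\<dots> \<le> (\<Sum>n | cutoff n \<le> k. 2 * \<rho> ^ k)"
    proof (intro sum_mono mult_left_mono)
      fix n assume "n \<in> {n. cutoff n \<le> k}"
      \<comment> \<open>\<open>cutoff n \<le> k\<close> means \<open>n div 20 < k - n\<close>, hence
        \<open>n < 20 * (k - n)\<close>.\<close>
      then have "k \<le> 21 * (k - n)" by (simp add: cutoff_def)
      then have "\<rho> ^ (21 * (k - n)) \<le> \<rho> ^ k"
        using \<rho> by (intro power_decreasing) auto
      then show "sqrt (1 / 2) ^ (k - n) \<le> \<rho> ^ k"
        unfolding power_mult \<rho>(3) .
    qed simp
    also have "\<dots> \<le> (\<Sum>n\<le>k. 2 * \<rho> ^ k)"
      using \<rho> cutoff_le_subset by (intro sum_mono2) auto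
    finally show ?thesis by (simp add: mult_ac)
  qed
  show "summable (\<lambda>k. 2 * (real (Suc k) * \<rho> ^ k))"
    using geometric_deriv_sums[of \<rho>] \<rho> by (intro summable_mult) (auto simp: sums_iff)
qed

text \<open>After exchanging the sums, each omitted block contributes at most \<open>2^(n/2)\<close>
  times its tail, because stage \<open>n\<close> is one of the nonnegative summands of
  \<open>tail\<close>. The error is \<open>O(2^(n/2))\<close>, below the scale
  \<open>sqrt (2^n ln n)\<close>.\<close>

lemma abs_tail_le:
  assumes "\<And>l. l \<ge> 1 \<Longrightarrow> summable (\<lambda>k. \<bar>g k (real (s l) * x)\<bar>)"
    and tail: "summable (\<lambda>k. tail k x)" and M: "M < 2 ^ (n + 1)"
  shows "\<bar>(\<Sum>l=1..M. \<Sum>k. g k (real (s l) * x)) - (\<Sum>l=1..M. \<Sum>k<cutoff n. g k (real (s l) * x))\<bar> \<le>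
    sqrt 2 ^ n * (\<Sum>k. tail k x)"
proof -
  let ?K = "cutoff n"
  define G where "G = (\<lambda>l k. \<bar>g (k + ?K) (real (s l) * x)\<bar>)"
  have sG: "summable (G l)" if "l \<in> {1..M}" for l
    using assms(1)[of l] that unfolding G_def by (subst summable_iff_shift) auto
  have tail_nonneg: "tail k x \<ge> 0" for k
    unfolding tail_def by (intro sum_nonneg mult_nonneg_nonneg) auto
  have tail_shift: "summable (\<lambda>k. tail (k + ?K) x)"
    using tail by (subst summable_iff_shift)
  have inv: "sqrt 2 ^ n * sqrt (1 / 2) ^ n = (1::real)"
    by (simp flip: power_mult_distrib real_sqrt_mult)
  have "\<bar>(\<Sum>l=1..M. \<Sum>k. g k (real (s l) * x)) - (\<Sum>l=1..M. \<Sum>k<?K. g k (real (s l) * x))\<bar> \<le>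
      (\<Sum>l=1..M. \<Sum>k. G l k)"
    unfolding sum_subtractf[symmetric]
  proof (rule order_trans[OF sum_abs], rule sum_mono)
    fix l assume l: "l \<in> {1..M}"
    have "summable (\<lambda>k. g k (real (s l) * x))"
      using assms(1)[of l] l by (auto intro: summable_rabs_cancel[of "\<lambda>k. g k (real (s l) * x)"])
    then have "(\<Sum>k. g k (real (s l) * x)) - (\<Sum>k<?K. g k (real (s l) * x)) =
        (\<Sum>k. g (k + ?K) (real (s l) * x))"
      by (subst suminf_minus_initial_segment) auto
    also have "\<bar>\<dots>\<bar> \<le> (\<Sum>k. G l k)"
      using sG[OF l] unfolding G_def by (rule summable_rabs)
    finally show "\<bar>(\<Sum>k. g k (real (s l) * x)) - (\<Sum>k<?K. g k (real (s l) * x))\<bar> \<le> (\<Sum>k. G l k)" .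
  qed
  also have "\<dots> = (\<Sum>k. \<Sum>l=1..M. G l k)"
    using sG by (rule suminf_sum[symmetric])
  also have "\<dots> \<le> (\<Sum>k. sqrt 2 ^ n * tail (k + ?K) x)"
  proof (rule suminf_le)
    fix k
    have "(\<Sum>l=1..M. G l k) \<le> (\<Sum>l=1..2^(n+1). G l k)"
      using M by (intro sum_mono2) (auto simp: G_def)
    also have "\<dots> = sqrt 2 ^ n * (sqrt (1 / 2) ^ n * (\<Sum>l=1..2^(n+1). G l k))"
      unfolding mult.assoc[symmetric] inv by simp
    also have "sqrt (1 / 2) ^ n * (\<Sum>l=1..2^(n+1). G l k) \<le> tail (k + ?K) x"
      unfolding tail_def G_def
      by (rule member_le_sum[of n "{n. cutoff n \<le> k + ?K}"
          "\<lambda>n. sqrt (1 / 2) ^ n * (\<Sum>l=1..2^(n+1). \<bar>g (k + ?K) (real (s l) * x)\<bar>)"])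
        (auto simp: finite_cutoff_le intro!: mult_nonneg_nonneg sum_nonneg)
    finally show "(\<Sum>l=1..M. G l k) \<le> sqrt 2 ^ n * tail (k + ?K) x" by simp
  next
    show "summable (\<lambda>k. \<Sum>l=1..M. G l k)" using sG by (rule summable_sum)
    show "summable (\<lambda>k. sqrt 2 ^ n * tail (k + ?K) x)" using tail_shift by (rule summable_mult)
  qed
  also have "\<dots> = sqrt 2 ^ n * (\<Sum>k. tail (k + ?K) x)"
    using tail_shift by (rule suminf_mult)
  also have "\<dots> \<le> sqrt 2 ^ n * (\<Sum>k. tail k x)"
    using suminf_split_initial_segment[OF tail, of ?K] tail_nonneg
    by (intro mult_left_mono) (auto intro!: sum_nonneg)
  finally show ?thesis .
qed

end

section \<open>The law of the iterated logarithm\<close>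

text \<open>For \<open>2^n \<le> L < 2^(n+1)\<close> the denominator is at least
  \<open>sqrt (2^n ln (n ln 2))\<close>. The given bound divided by this is
  \<open>\<beta> n\<close>, which tends to \<open>14 sqrt D < c\<close>.\<close>

lemma limsup_le_of_dyadic_bound:
  fixes z :: "nat \<Rightarrow> real"
  assumes bound: "\<forall>\<^sub>F n in sequentially. \<forall>M<2^(n+1).
      z M \<le> sqrt (D * 2 ^ n * ln (real n)) * (14 + 110 / (3 * ln (real n))) + sqrt 2 ^ n * C"
    and D: "D > 0" "14 * sqrt D < c"
  shows "limsup (\<lambda>L. ereal (z L / sqrt (real L * ln (ln (real L))))) \<le> ereal c"
proof -
  define \<beta> where "\<beta> = (\<lambda>n. sqrt D * (sqrt (ln (real n) / ln (real n * ln 2)) * (14 + 110 / (3 * ln (real n)))) +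
    C * (1 / sqrt (ln (real n * ln 2))))"
  have "\<beta> \<longlonglongrightarrow> sqrt D * 14 + C * 0"
    unfolding \<beta>_def by (intro tendsto_add tendsto_mult_left) real_asymp+
  then have "\<forall>\<^sub>F n in sequentially. \<beta> n < c"
    using D(2) by (auto dest!: order_tendstoD(2)[where a=c] simp: mult.commute)
  \<comment> \<open>Makes the logarithm of \<open>n ln 2\<close>, hence the denominator,
    positive.\<close>
  moreover have "\<forall>\<^sub>F n in sequentially. real n * ln 2 > 1" by real_asymp
  ultimately have "\<forall>\<^sub>F n in sequentially. \<forall>L. 2 ^ n \<le> L \<longrightarrow> L < 2 ^ (n + 1) \<longrightarrow>
      z L / sqrt (real L * ln (ln (real L))) \<le> c"
    using bound
  proof eventually_elim
    case (elim n)
    show ?case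
    proof (intro allI impI)
      fix L :: nat assume L: "2 ^ n \<le> L" "L < 2 ^ (n + 1)"
      define A where "A = ln (real n * ln 2)"
      have A: "A > 0" using elim(2) by (simp add: A_def)
      have n: "n \<ge> 2"
      proof (rule ccontr)
        assume "\<not> n \<ge> 2"
        then have "real n * ln 2 \<le> 1 * ln 2" by (intro mult_right_mono) auto
        then show False using elim(2) ln_2_less_1 by linarith
      qed
      then have ln: "ln (real n) > 0" by simp
      have L': "(2::real) ^ n \<le> real L" using L(1) by (metis of_nat_le_iff of_nat_numeral of_nat_power)
      then have "real L > 0" by (rule less_le_trans[rotated]) simp
      with L' have "ln (2 ^ n) \<le> ln (real L)" by (subst ln_le_cancel_iff) auto
      then have "real n * ln 2 \<le> ln (real L)" by (simp add: ln_realpow)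
      then have lnln: "A \<le> ln (ln (real L))"
        using elim(2) unfolding A_def by (subst ln_le_cancel_iff) auto
      have den: "sqrt (2 ^ n * A) \<le> sqrt (real L * ln (ln (real L)))"
        using L' lnln A by (intro real_sqrt_le_mono mult_mono) auto
      have pos: "sqrt (2 ^ n * A) > 0" using A by simp
      have "z L \<le> sqrt (D * 2 ^ n * ln (real n)) * (14 + 110 / (3 * ln (real n))) + sqrt 2 ^ n * C"
        using elim(3) L(2) by blast
      also have "\<dots> = \<beta> n * sqrt (2 ^ n * A)"
      proof -
        have "sqrt (D * 2 ^ n * ln (real n)) = sqrt D * sqrt (ln (real n) / A) * sqrt (2 ^ n * A)"
          using A by (simp flip: real_sqrt_mult)
        moreover have "sqrt 2 ^ n = 1 / sqrt A * sqrt (2 ^ n * A)"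
          using A by (simp add: real_sqrt_mult real_sqrt_power)
        ultimately show ?thesis
          unfolding \<beta>_def A_def[symmetric] by (simp only: distrib_left distrib_right mult_ac)
      qed
      also have "\<dots> \<le> c * sqrt (2 ^ n * A)"
        using elim(1) pos by (intro mult_right_mono) auto
      also have "\<dots> \<le> c * sqrt (real L * ln (ln (real L)))"
      proof (rule mult_left_mono[OF den])
        have "0 \<le> 14 * sqrt D" using D(1) by simp
        then show "0 \<le> c" using D(2) by linarith
      qed
      finally show "z L / sqrt (real L * ln (ln (real L))) \<le> c"
        using pos den by (simp add: pos_divide_le_eq)
    qed
  qed
  then obtain N where N: "\<And>n L. n \<ge> N \<Longrightarrow> 2 ^ n \<le> L \<Longrightarrow> L < 2 ^ (n + 1) \<Longrightarrow>
      z L / sqrt (real L * ln (ln (real L))) \<le> c"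
    unfolding eventually_sequentially by blast
  show ?thesis
  proof (rule Limsup_bounded, rule eventually_sequentiallyI[of "2 ^ N"])
    fix L :: nat assume L: "2 ^ N \<le> L"
    then have "L \<ge> 1" using one_le_power[of "2::nat" N] by linarith
    then obtain n where n: "2 ^ n \<le> L" "L < 2 ^ (n + 1)"
      using ex_power_ivl1[of 2 L] by auto
    then have "(2::nat) ^ N < 2 ^ (n + 1)" using L by linarith
    then have "N < n + 1" by (simp only: power_strict_increasing_iff)
    then show "ereal (z L / sqrt (real L * ln (ln (real L)))) \<le> ereal c"
      using N[of n L] n by (simp del: power_Suc)
  qed
qed

theorem theorem5:
  fixes f :: "real \<Rightarrow> real" and s :: "nat \<Rightarrow> nat" and q :: real
  assumes "f \<in> borel_measurable lebesgue"
    and "\<And>x. f (- x) = f x"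
    and "\<And>x. f (x + 1) = f x"
    and "(LINT x:{0<..<1}|lebesgue. f x) = 0"
    and "set_integrable lebesgue {0<..<1} (\<lambda>x. (f x)\<^sup>2)"
    and "\<And>j. j \<ge> 1 \<Longrightarrow> \<bar>fourier_cos_coeff f j\<bar> \<le> 1 / real j"
    and "\<And>j. j \<ge> 1 \<Longrightarrow> \<bar>fourier_sin_coeff f j\<bar> \<le> 1 / real j"
    and "q > 1"
    and "\<And>l. l \<ge> 1 \<Longrightarrow> s l > 0"
    and "\<And>l. l \<ge> 1 \<Longrightarrow> real (s (l + 1)) / real (s l) \<ge> q"
  shows "AE \<alpha> in lebesgue. \<alpha> \<in> {0<..<1} \<longrightarrow>
    limsup (\<lambda>L. ereal (\<bar>\<Sum>l=1..L. f (real (s l) * \<alpha>)\<bar> / sqrt (real L * ln (ln (real L)))))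
      \<le> ereal (max (85 * q / (q - 1)) (122 * L2_norm_01 f powr (1/4) * (sqrt q / (sqrt q - 1))))"
proof -
  \<comment> \<open>Bernoulli gives \<open>q^r \<ge> 1 + r (q - 1) \<ge> 2\<close>, while rounding
    up keeps \<open>r \<le> 1 / (q - 1) + 1 = q / (q - 1)\<close>.\<close>
  define r where "r = nat \<lceil>1 / (q - 1)\<rceil>"
  have q1: "1 / (q - 1) > 0" using \<open>q > 1\<close> by simp
  have r: "r \<ge> 1" "1 / (q - 1) \<le> real r" "real r \<le> q / (q - 1)"
  proof -
    have ceil: "\<lceil>1 / (q - 1)\<rceil> \<ge> 1" using q1 by (simp add: one_le_ceiling)
    then show "r \<ge> 1" unfolding r_def by linarith
    have r_real: "real r = of_int \<lceil>1 / (q - 1)\<rceil>" using ceil by (simp add: r_def)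
    show "1 / (q - 1) \<le> real r" unfolding r_real by (rule le_of_int_ceiling)
    have "real r \<le> 1 / (q - 1) + 1" unfolding r_real by linarith
    also have "\<dots> = q / (q - 1)" using \<open>q > 1\<close> by (simp add: field_simps)
    finally show "real r \<le> q / (q - 1)" .
  qed
  have "1 \<le> real r * (q - 1)" using r(2) \<open>q > 1\<close> by (simp add: field_simps)
  then have q_r: "2 \<le> q ^ r"
    using Bernoulli_inequality[of "q - 1" r] \<open>q > 1\<close> by simp
  have growth: "q ^ n * real (s l) \<le> real (s (l + n))" if "l \<ge> 1" for l n
  proof (induction n)
    case (Suc n)
    have "q ^ Suc n * real (s l) = q * (q ^ n * real (s l))" by simp
    also have "\<dots> \<le> q * real (s (l + n))"
      using Suc \<open>q > 1\<close> by (intro mult_left_mono) auto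
    also have "\<dots> \<le> real (s (l + n + 1))"
      using assms(10)[of "l + n"] assms(9)[of "l + n"] that by (simp add: pos_le_divide_eq)
    finally show ?case by simp
  qed simp
  interpret lacunary_cosine "fourier_cos_coeff f" s r
  proof
    show "2 * s l \<le> s (l + r)" if "l \<ge> 1" for l
    proof -
      have "2 * real (s l) \<le> q ^ r * real (s l)" using q_r by (intro mult_right_mono) auto
      also have "\<dots> \<le> real (s (l + r))" by (rule growth[OF that])
      finally show ?thesis by linarith
    qed
  qed (use assms r in auto)
  have f_meas: "f \<in> borel_measurable unit_measure"
    using assms(1) by (rule measurable_restrict_space1)
  have f2: "integrable unit_measure (\<lambda>x. (f x)\<^sup>2)"
    using assms(5) by (simp add: set_integrable_def integrable_restrict_space)
  have f_int: "integrable unit_measure f"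
  proof (rule Bochner_Integration.integrable_bound)
    show "integrable unit_measure (\<lambda>x. 1 + (f x)\<^sup>2)"
      by (intro Bochner_Integration.integrable_add f2 integrable_unit continuous_on_const)
    show "AE x in unit_measure. norm (f x) \<le> norm (1 + (f x)\<^sup>2)"
    proof (rule AE_I2)
      fix x
      have "0 \<le> (\<bar>f x\<bar> - 1 / 2)\<^sup>2" by simp
      then have "\<bar>f x\<bar> \<le> (f x)\<^sup>2 + 1 / 4" by (simp add: power2_diff power_divide)
      then show "norm (f x) \<le> norm (1 + (f x)\<^sup>2)" by simp
    qed
  qed (rule f_meas)
  have f_period: "f (x + of_int i) = f x" for x i
  proof (induction i rule: int_induct[where k=0])
    case (step1 i)
    then show ?case using assms(3)[of "x + of_int i"] by (simp add: add_ac)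
  next
    case (step2 i)
    then show ?case using assms(3)[of "x + of_int (i - 1)"] by (simp add: add_ac)
  qed simp
  \<comment> \<open>This property is invariant under integer shifts, as \<open>f\<close> and all
    blocks have period 1; so it passes to the dilates \<open>s l * x\<close>, for all
    \<open>l\<close> simultaneously by countability.\<close>
  define P where "P = (\<lambda>x. summable (\<lambda>k. \<bar>g k x\<bar>) \<and> f x = (\<Sum>k. g k x))"
  have "AE x in unit_measure. P x"
    unfolding P_def
  proof (rule AE_eq_dyadic_series[OF f_int])
    show "f (1 - x) = f x" for x
      using assms(2)[of x] assms(3)[of "- x"] by simp
    show "integral\<^sup>L unit_measure f = 0"
      using assms(4) by (simp add: integral_unit_eq)
    show "integral\<^sup>L unit_measure (\<lambda>x. f x * cosine j x) = fourier_cos_coeff f j / 2" for j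
      by (simp add: integral_unit_eq fourier_cos_coeff_def)
  qed
  then have "AE x in unit_measure. P (real (s l) * x)" if "l \<ge> 1" for l
    by (rule AE_dilate_periodic) (use assms(9)[OF that] in \<open>auto simp: P_def f_period g_periodic\<close>)
  then have AE_P: "AE x in unit_measure. \<forall>l\<in>{1..}. P (real (s l) * x)"
    by (subst AE_ball_countable) auto
  have c: "14 * sqrt D < max (85 * q / (q - 1)) (122 * L2_norm_01 f powr (1/4) * (sqrt q / (sqrt q - 1)))"
  proof -
    \<comment> \<open>\<open>(28/5)^2 = 31.36\<close> and \<open>r \<ge> 1\<close>; then
      \<open>14 * 28/5 = 78.4 < 85\<close> leaves the strict margin needed for the limsup.\<close>
    have "31 * real r \<le> (28 / 5 * real r)\<^sup>2"
      using r(1) by (simp add: power2_eq_square)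
    then have "sqrt D \<le> 28 / 5 * real r"
      unfolding D_def by (intro real_le_lsqrt) auto
    then have "14 * sqrt D < 85 * (q / (q - 1))" using r(1,3) by linarith
    then show ?thesis by simp
  qed
  have "AE x in unit_measure.
    limsup (\<lambda>L. ereal (\<bar>\<Sum>l=1..L. f (real (s l) * x)\<bar> / sqrt (real L * ln (ln (real L)))))
      \<le> ereal (max (85 * q / (q - 1)) (122 * L2_norm_01 f powr (1/4) * (sqrt q / (sqrt q - 1))))"
    using AE_P AE_summable_tail AE_truncated_sums_le
  proof eventually_elim
    case (elim x)
    have sum: "summable (\<lambda>k. \<bar>g k (real (s l) * x)\<bar>)" if "l \<ge> 1" for l
      using elim(1) that by (auto simp: P_def)
    show ?case
    proof (rule limsup_le_of_dyadic_bound[OF _ _ c])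
      show "D > 0" using D_ge by simp
      show "\<forall>\<^sub>F n in sequentially. \<forall>M<2^(n+1). \<bar>\<Sum>l=1..M. f (real (s l) * x)\<bar> \<le>
        sqrt (D * 2 ^ n * ln (real n)) * (14 + 110 / (3 * ln (real n))) + sqrt 2 ^ n * (\<Sum>k. tail k x)"
        using elim(3)
      proof eventually_elim
        case (elim n)
        show ?case
        proof (intro allI impI)
          fix M :: nat assume M: "M < 2 ^ (n + 1)"
          have "(\<Sum>l=1..M. f (real (s l) * x)) = (\<Sum>l=1..M. \<Sum>k. g k (real (s l) * x))"
            using \<open>\<forall>l\<in>{1..}. P (real (s l) * x)\<close> by (intro sum.cong) (auto simp: P_def)
          then show "\<bar>\<Sum>l=1..M. f (real (s l) * x)\<bar> \<le>
            sqrt (D * 2 ^ n * ln (real n)) * (14 + 110 / (3 * ln (real n))) + sqrt 2 ^ n * (\<Sum>k. tail k x)"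
            using abs_tail_le[OF sum \<open>summable (\<lambda>k. tail k x)\<close> M] elim[rule_format, OF M] by linarith
        qed
      qed
    qed
  qed
  then show ?thesis
    by (subst (asm) AE_restrict_space_iff) auto
qed

end
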